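(* Let $1<p<\infty$, $1/p+1/p'=1$, and assume that the weight $w$ on $\mathbb R^n$ satisfies, for some $r>1$ and $K>0$, $$\Bigl(\frac1{|Q|}\int_Q w\Bigr)^{1/p}\Bigl(\frac1{|Q|}\int_Q w^{-rp'/p}\Bigr)^{1/(rp')}\le K$$ for all cubes $Q\subset\mathbb R^n$. Let $1/r+1/r'=1$. Let $H$ be a non-negative measurable function on $\mathbb R^n\times\mathbb R^n$ such that for some $\sigma>r'p'$ and some $C_H>0$ $$\int_{|y|<s}H(x,y)^\sigma\,dy\le C_H\,s^n\qquad\text{for all }x\in\mathbb R^n,\ s>0 .$$ Then the maximal operator $M_H$ is bounded on $L^p_w$ with operator norm bounded by $CK$, where the constant $C$ is independent of $w$ and $K$ and depends on $H$ only through $C_H$ (and $\sigma$).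
   Context: $M_Hf(x)=\sup_{s>0}\frac1{s^n}\int_{|y|<s}H(x,y)\,|f(x-y)|\,dy$. A weight is a non-negative measurable function, and $L^p_w=L^p(\mathbb R^n,w(x)\,dx)$. *)

theory Defs
  imports "HOL-Analysis.Analysis"
begin

(* Real powers on [0,\<infinity>].  The library's powr on the reals sets 0 powr a = 0 for every a,
   which is wrong for the negative powers of a weight: here 0 to a negative power is \<infinity>
   and \<infinity> to a negative power is 0.  In products, 0 * \<infinity> = 0 as usual for ennreal. *)

definition epowr :: "ennreal \<Rightarrow> real \<Rightarrow> ennreal"  (infixr "epowr" 80) where
  "x epowr a =
     (if a = 0 then 1
      else if x = 0 then (if 0 < a then 0 else \<infinity>)
      else if x = \<infinity> then (if 0 < a then \<infinity> else 0)
      else ennreal (enn2real x powr a))"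

(* Cubes have sides parallel to the coordinate axes; vec l = (l, ..., l). *)

definition cubes :: "(real ^ 'n) set set" where
  "cubes = {cbox a (a + vec l) | a l. 0 < l}"

definition average :: "(real ^ 'n) set \<Rightarrow> (real ^ 'n \<Rightarrow> ennreal) \<Rightarrow> ennreal" where
  "average Q g = (\<integral>\<^sup>+x\<in>Q. g x \<partial>lebesgue) / emeasure lebesgue Q"

(* Non-negative functions are rendered as functions into ennreal; measurable means
   Lebesgue measurable. *)

definition weight :: "(real ^ 'n \<Rightarrow> ennreal) \<Rightarrow> bool" where
  "weight w \<longleftrightarrow> w \<in> borel_measurable lebesgue"

definition maximal_op ::
    "((real ^ 'n) \<times> (real ^ 'n) \<Rightarrow> ennreal) \<Rightarrow> (real ^ 'n \<Rightarrow> complex) \<Rightarrow> real ^ 'n \<Rightarrow> ennreal" where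
  "maximal_op H f x =
     (SUP s\<in>{0<..}. ennreal (1 / s ^ CARD('n)) *
        (\<integral>\<^sup>+y\<in>{y. norm y < s}. H (x, y) * ennreal (cmod (f (x - y))) \<partial>lebesgue))"

(* The L^p_w norm is the L^p norm of the measure w(x) dx, applied to the modulus. *)

definition Lpw_norm :: "real \<Rightarrow> (real ^ 'n \<Rightarrow> ennreal) \<Rightarrow> (real ^ 'n \<Rightarrow> ennreal) \<Rightarrow> ennreal" where
  "Lpw_norm p w g = (\<integral>\<^sup>+x. g x epowr p \<partial>density lebesgue w) epowr (1 / p)"

definition Lpw_nonneg :: "real \<Rightarrow> (real ^ 'n \<Rightarrow> ennreal) \<Rightarrow> (real ^ 'n \<Rightarrow> ennreal) set" where
  "Lpw_nonneg p w = {g \<in> borel_measurable lebesgue. Lpw_norm p w g < \<infinity>}"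

definition Lpw :: "real \<Rightarrow> (real ^ 'n \<Rightarrow> ennreal) \<Rightarrow> (real ^ 'n \<Rightarrow> complex) set" where
  "Lpw p w = {f \<in> borel_measurable lebesgue. Lpw_norm p w (\<lambda>x. ennreal (cmod (f x))) < \<infinity>}"

definition Lpw_op_norm ::
    "real \<Rightarrow> (real ^ 'n \<Rightarrow> ennreal) \<Rightarrow> ((real ^ 'n \<Rightarrow> complex) \<Rightarrow> real ^ 'n \<Rightarrow> ennreal) \<Rightarrow> ennreal" where
  "Lpw_op_norm p w T =
     Inf {B. \<forall>f\<in>Lpw p w. Lpw_norm p w (T f) \<le> B * Lpw_norm p w (\<lambda>x. ennreal (cmod (f x)))}"

definition Lpw_bounded ::
    "real \<Rightarrow> (real ^ 'n \<Rightarrow> ennreal) \<Rightarrow> ((real ^ 'n \<Rightarrow> complex) \<Rightarrow> real ^ 'n \<Rightarrow> ennreal) \<Rightarrow> bool" where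
  "Lpw_bounded p w T \<longleftrightarrow> (\<forall>f\<in>Lpw p w. T f \<in> Lpw_nonneg p w) \<and> Lpw_op_norm p w T < \<infinity>"

end

(* Hoelder's inequality with exponents \<sigma>, \<sigma>' bounds M_H f pointwise by C_H^(1/\<sigma>) (M |f|^\<sigma>')^(1/\<sigma>'), where M is
   the centred Hardy-Littlewood maximal operator.  The bumped condition on w says that w is a
   Muckenhoupt A_t weight with constant K^p for t = 1 + (p - 1)/r, and \<sigma> > r'p' means t < p/\<sigma>'.
   By Vitali covering M is of weak type (t, t) on L^t_w with constant a multiple of K^p; as it is
   bounded on L^\<infinity>, Marcinkiewicz interpolation makes it bounded on L^(p/\<sigma>')_w, and the p-th root of
   the resulting constant is linear in K. *)

theory Submission
  imports Defs
begin

subsection \<open>Powers on the extended non-negative reals\<close>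

text \<open>The choice of endpoints makes the dependence on \<open>K\<close> linear. The weak type
  constant at \<open>t\<close> is linear in the Muckenhoupt constant, and the L^\<infinity> bound
  does not see the weight, so interpolation at p/\<sigma>' > t keeps the first power of K^p. The
  bump r > 1 is what puts \<open>t\<close> below \<open>p\<close>, and the integrability of
  \<open>H\<close> decides how much of this room Hoelder's inequality may consume.

  Two obstacles shape the rest. First, weights take values in [0,\<infinity>], and there a negative
  power of 0 is \<infinity>. A weight with the bumped condition turns out to be almost everywhere 0,
  almost everywhere \<infinity>, or almost everywhere strictly between; the covering argument runs
  in the third case. Second, \<open>H\<close> is Lebesgue measurable on the product, which controls
  only almost every section. Hence \<open>f\<close>, \<open>H\<close> and \<open>w\<close> are
  replaced by Borel representatives and the pointwise estimate holds for almost every point.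

  All constants are kept explicit, because the final one has to be chosen before the weight,
  \<open>K\<close> and \<open>H\<close>.\<close>

lemma epowr_0_right [simp]: "x epowr 0 = 1"
  by (simp add: epowr_def)

lemma epowr_1_left [simp]: "1 epowr a = 1"
  by (simp add: epowr_def)

lemma epowr_0_left: "0 < a \<Longrightarrow> 0 epowr a = 0"
  by (simp add: epowr_def)

lemma epowr_top_left: "0 < a \<Longrightarrow> top epowr a = top"
  by (simp add: epowr_def)

lemma epowr_1_right [simp]: "x epowr 1 = x"
  by (cases x) (auto simp: epowr_def)

lemma ennreal_epowr: "0 < x \<Longrightarrow> ennreal x epowr a = ennreal (x powr a)"
  by (auto simp: epowr_def)

lemma epowr_cases [case_names zero top pos]:
  fixes x :: ennreal
  obtains "x = 0" | "x = top" | u where "0 < u" "x = ennreal u"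
proof (cases x)
  case (real u)
  then show ?thesis using that by (cases "u = 0") auto
qed

lemma epowr_mono:
  assumes "0 \<le> a" "x \<le> y"
  shows "x epowr a \<le> y epowr a"
proof (cases "a = 0")
  case False
  then have a: "0 < a" using assms by simp
  show ?thesis
    using assms(2) a
    by (cases x rule: epowr_cases; cases y rule: epowr_cases)
       (auto simp: epowr_0_left epowr_top_left ennreal_epowr top_unique intro!: ennreal_leI powr_mono2)
qed simp

lemma epowr_epowr: "(x epowr a) epowr b = x epowr (a * b)"
  by (cases x rule: epowr_cases)
     (auto simp: epowr_def powr_powr zero_less_mult_iff mult_less_0_iff)

text \<open>For negative \<open>a\<close> this fails at \<open>x = 0\<close>,
  \<open>y = top\<close>: the left side is \<open>top\<close>, the right side is
  \<open>top * 0 = 0\<close>. The same clash of 0 and \<open>top\<close> is why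
  \<open>epowr_add\<close> asks for two positive exponents.\<close>

lemma epowr_mult:
  assumes "0 < a"
  shows "(x * y) epowr a = x epowr a * y epowr a"
  using assms
  by (cases x rule: epowr_cases; cases y rule: epowr_cases)
     (auto simp: epowr_0_left epowr_top_left ennreal_epowr ennreal_mult_top ennreal_top_mult
        powr_mult simp flip: ennreal_mult)

lemma epowr_add:
  assumes "0 < a" "0 < b"
  shows "x epowr (a + b) = x epowr a * x epowr b"
  using assms
  by (cases x rule: epowr_cases)
     (auto simp: epowr_0_left epowr_top_left ennreal_epowr powr_add ennreal_mult_top simp flip: ennreal_mult)

lemma epowr_eq_0_iff: "0 < a \<Longrightarrow> x epowr a = 0 \<longleftrightarrow> x = 0"
  by (cases x rule: epowr_cases) (auto simp: epowr_def)

lemma borel_measurable_epowr [measurable (raw)]: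
  assumes [measurable]: "f \<in> borel_measurable M"
  shows "(\<lambda>x. f x epowr a) \<in> borel_measurable M"
  unfolding epowr_def by measurable

section \<open>Young's and Hoelder's inequalities with values in [0,\<infinity>]\<close>

lemma Youngs_inequality_ennreal:
  assumes "1 < p" "1 < q" "1 / p + 1 / q = 1"
  shows "x * y \<le> x epowr p * ennreal (1 / p) + y epowr q * ennreal (1 / q)"
proof -
  have pq: "0 < p" "0 < q" using assms by auto
  show ?thesis
  proof (cases x rule: epowr_cases)
    case zero
    then show ?thesis by simp
  next
    case top
    then show ?thesis using pq by (simp add: epowr_top_left ennreal_top_mult)
  next
    case (pos u)
    note u = this
    show ?thesis
    proof (cases y rule: epowr_cases)
      case zero
      then show ?thesis by simp
    next
      case top
      then show ?thesis using pq by (simp add: epowr_top_left ennreal_top_mult)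
    next
      case (pos v)
      have "u * v \<le> u powr p / p + v powr q / q"
        using assms u pos by (intro Youngs_inequality) auto
      then have "ennreal (u * v) \<le> ennreal (u powr p * (1 / p) + v powr q * (1 / q))"
        by (intro ennreal_leI) simp
      then show ?thesis
        using u pos pq by (simp add: ennreal_epowr flip: ennreal_mult)
    qed
  qed
qed

text \<open>Normalising by the two norms reduces the claim to Young's inequality. A vanishing norm
  makes the product 0 almost everywhere; if one norm is infinite and the other nonzero, the right
  side is \<open>top\<close>.\<close>

lemma nn_integral_Hoelder:
  fixes f g :: "'a \<Rightarrow> ennreal"
  assumes pq: "1 < p" "1 < q" "1 / p + 1 / q = 1"
    and [measurable]: "f \<in> borel_measurable M" "g \<in> borel_measurable M"
  shows "(\<integral>\<^sup>+x. f x * g x \<partial>M)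
      \<le> (\<integral>\<^sup>+x. f x epowr p \<partial>M) epowr (1 / p) * (\<integral>\<^sup>+x. g x epowr q \<partial>M) epowr (1 / q)"
proof -
  have pq0: "0 < p" "0 < q" using pq by auto
  define A where "A = (\<integral>\<^sup>+x. f x epowr p \<partial>M) epowr (1 / p)"
  define B where "B = (\<integral>\<^sup>+x. g x epowr q \<partial>M) epowr (1 / q)"
  have Ap: "A epowr p = (\<integral>\<^sup>+x. f x epowr p \<partial>M)" and Bq: "B epowr q = (\<integral>\<^sup>+x. g x epowr q \<partial>M)"
    using pq0 by (simp_all add: A_def B_def epowr_epowr)
  have "(\<integral>\<^sup>+x. f x * g x \<partial>M) \<le> A * B"
  proof (cases "A = 0 \<or> B = 0")
    case True
    then have "AE x in M. f x * g x = 0"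
    proof
      assume "A = 0"
      then have "(\<integral>\<^sup>+x. f x epowr p \<partial>M) = 0" using Ap pq0 by (simp add: epowr_0_left)
      then show ?thesis by (subst (asm) nn_integral_0_iff_AE) (use pq0 in \<open>auto simp: epowr_eq_0_iff\<close>)
    next
      assume "B = 0"
      then have "(\<integral>\<^sup>+x. g x epowr q \<partial>M) = 0" using Bq pq0 by (simp add: epowr_0_left)
      then show ?thesis by (subst (asm) nn_integral_0_iff_AE) (use pq0 in \<open>auto simp: epowr_eq_0_iff\<close>)
    qed
    then have "(\<integral>\<^sup>+x. f x * g x \<partial>M) = 0"
      by (simp add: nn_integral_0_iff_AE)
    then show ?thesis by simp
  next
    case False
    show ?thesis
    proof (cases "A = \<infinity> \<or> B = \<infinity>")
      case True
      then show ?thesis using False by (auto simp: ennreal_mult_top ennreal_top_mult)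
    next
      case F2: False
      obtain a where a: "0 < a" "A = ennreal a" using False F2 by (cases A rule: epowr_cases) auto
      obtain b where b: "0 < b" "B = ennreal b" using False F2 by (cases B rule: epowr_cases) auto
      \<comment> \<open>Young's inequality for \<open>f / A\<close> and \<open>g / B\<close>,
        multiplied back by \<open>A * B\<close>; after integration the bracket becomes
        \<open>1 / p + 1 / q = 1\<close>.\<close>
      have *: "f x * g x \<le> A * B * (ennreal (1 / p / a powr p) * f x epowr p
          + ennreal (1 / q / b powr q) * g x epowr q)" for x
      proof -
        have "f x * g x = A * B * ((ennreal (1 / a) * f x) * (ennreal (1 / b) * g x))"
        proof -
          have "A * ennreal (1 / a) = 1" "B * ennreal (1 / b) = 1"
            using a b by (simp_all flip: ennreal_mult)
          then show ?thesis by (metis (no_types, lifting) mult.assoc mult.commute mult.left_neutral)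
        qed
        also have "\<dots> \<le> A * B * ((ennreal (1 / a) * f x) epowr p * ennreal (1 / p)
             + (ennreal (1 / b) * g x) epowr q * ennreal (1 / q))"
          by (intro mult_left_mono Youngs_inequality_ennreal pq) auto
        also have "(ennreal (1 / a) * f x) epowr p * ennreal (1 / p) = ennreal (1 / p / a powr p) * f x epowr p"
          using a pq0 by (simp add: epowr_mult ennreal_epowr powr_divide mult.commute[of _ "ennreal (1 / p)"]
              mult.assoc[symmetric] flip: ennreal_mult)
        also have "(ennreal (1 / b) * g x) epowr q * ennreal (1 / q) = ennreal (1 / q / b powr q) * g x epowr q"
          using b pq0 by (simp add: epowr_mult ennreal_epowr powr_divide mult.commute[of _ "ennreal (1 / q)"]
              mult.assoc[symmetric] flip: ennreal_mult)
        finally show ?thesis .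
      qed
      have "(\<integral>\<^sup>+x. f x * g x \<partial>M) \<le> (\<integral>\<^sup>+x. A * B * (ennreal (1 / p / a powr p) * f x epowr p
          + ennreal (1 / q / b powr q) * g x epowr q) \<partial>M)"
        by (intro nn_integral_mono *)
      also have "\<dots> = A * B * (ennreal (1 / p / a powr p) * A epowr p
          + ennreal (1 / q / b powr q) * B epowr q)"
        by (simp add: nn_integral_cmult nn_integral_add Ap Bq)
      also have "ennreal (1 / p / a powr p) * A epowr p = ennreal (1 / p)"
        using a pq0 by (simp add: ennreal_epowr flip: ennreal_mult)
      also have "ennreal (1 / q / b powr q) * B epowr q = ennreal (1 / q)"
        using b pq0 by (simp add: ennreal_epowr flip: ennreal_mult)
      also have "ennreal (1 / p) + ennreal (1 / q) = 1"
        using pq pq0 by (simp flip: ennreal_plus)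
      finally show ?thesis by simp
    qed
  qed
  then show ?thesis by (simp add: A_def B_def)
qed

subsection \<open>The centred maximal function and its weak type bound\<close>

text \<open>Vitali's lemma returns a countable set of centres without an enumeration, so the sum in
  countable subadditivity is taken as an integral over \<open>count_space\<close>.\<close>

lemma emeasure_UN_le_nn_integral_count_space:
  assumes [measurable]: "\<And>i. i \<in> I \<Longrightarrow> X i \<in> sets M" and I: "countable I"
  shows "emeasure M (\<Union>(X ` I)) \<le> (\<integral>\<^sup>+i. emeasure M (X i) \<partial>count_space I)"
proof -
  have [measurable]: "\<Union>(X ` I) \<in> sets M"
    using I by (intro sets.countable_UN') auto
  have "emeasure M (\<Union>(X ` I)) = (\<integral>\<^sup>+x. indicator (\<Union>(X ` I)) x \<partial>M)"
    by simp
  also have "\<dots> \<le> (\<integral>\<^sup>+x. \<integral>\<^sup>+i. indicator (X i) x \<partial>count_space I \<partial>M)"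
  proof (intro nn_integral_mono)
    fix x
    show "(indicator (\<Union>(X ` I)) x :: ennreal) \<le> (\<integral>\<^sup>+i. indicator (X i) x \<partial>count_space I)"
    proof (cases "x \<in> \<Union>(X ` I)")
      case True
      then obtain j where "j \<in> I" "x \<in> X j" by auto
      then have "(1 :: ennreal) = (\<integral>\<^sup>+i. indicator {j} i \<partial>count_space I)"
        by simp
      also have "\<dots> \<le> (\<integral>\<^sup>+i. indicator (X i) x \<partial>count_space I)"
        using \<open>x \<in> X j\<close> by (intro nn_integral_mono) (auto split: split_indicator)
      finally show ?thesis using True by simp
    qed simp
  qed
  also have "\<dots> = (\<integral>\<^sup>+i. \<integral>\<^sup>+x. indicator (X i) x \<partial>M \<partial>count_space I)"
    using I by (intro nn_integral_count_space_nn_integral) auto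
  also have "\<dots> = (\<integral>\<^sup>+i. emeasure M (X i) \<partial>count_space I)"
    by (intro nn_integral_cong) auto
  finally show ?thesis .
qed

text \<open>The centred Hardy-Littlewood maximal function, normalised by \<open>s ^ n\<close> as in
  \<open>maximal_op\<close> and not by the volume of the ball: on the constant 1 it equals the
  volume of the unit ball, which is the source of the factors \<open>unit_ball_vol\<close>
  below.\<close>

definition ball_max :: "('a::euclidean_space \<Rightarrow> ennreal) \<Rightarrow> 'a \<Rightarrow> ennreal" where
  "ball_max F x = (SUP s\<in>{0<..}. ennreal (1 / s ^ DIM('a)) * (\<integral>\<^sup>+y\<in>ball x s. F y \<partial>lborel))"

text \<open>Continuity from below of the measure with density \<open>F\<close> along increasing open
  balls. The room between \<open>q\<close> and \<open>s\<close> allows moving the centre, which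
  makes superlevel sets open, or moving the radius to a rational.\<close>

lemma less_set_nn_integral_ball:
  fixes F :: "'a::euclidean_space \<Rightarrow> ennreal"
  assumes [measurable]: "F \<in> borel_measurable borel"
    and s: "0 < s" and less: "b < c * (\<integral>\<^sup>+y\<in>ball x s. F y \<partial>lborel)"
  obtains q where "0 < q" "q < s" "b < c * (\<integral>\<^sup>+y\<in>ball x q. F y \<partial>lborel)"
proof -
  \<comment> \<open>The shift by 2 keeps \<open>r 0 = s / 2\<close> positive.\<close>
  define r where "r k = s - s / real (k + 2)" for k :: nat
  have r: "0 < r k" "r k < s" for k
    using s by (auto simp: r_def field_simps add_pos_nonneg)
  have inc: "incseq r"
    using s by (auto simp: incseq_def r_def intro!: divide_left_mono)
  have lim: "r \<longlonglongrightarrow> s"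
  proof -
    have "(\<lambda>k. s - s / real (k + 2)) \<longlonglongrightarrow> s - 0"
      by (intro tendsto_intros LIMSEQ_ignore_initial_segment[OF lim_const_over_n])
    then show ?thesis by (simp add: r_def[abs_def])
  qed
  have Un: "(\<Union>k. ball x (r k)) = ball x s"
  proof (intro equalityI subsetI)
    fix y assume "y \<in> ball x s"
    then have "\<forall>\<^sub>F k in sequentially. dist x y < r k"
      using order_tendstoD(1)[OF lim] by auto
    then obtain k where "dist x y < r k" by (auto simp: eventually_sequentially)
    then show "y \<in> (\<Union>k. ball x (r k))" by auto
  next
    fix y assume "y \<in> (\<Union>k. ball x (r k))"
    then obtain k where "dist x y < r k" by auto
    then show "y \<in> ball x s" using r(2)[of k] by auto
  qed
  have "(\<integral>\<^sup>+y\<in>ball x s. F y \<partial>lborel) = emeasure (density lborel F) (ball x s)"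
    by (simp add: emeasure_density)
  also have "\<dots> = (SUP k. emeasure (density lborel F) (ball x (r k)))"
    using inc by (subst SUP_emeasure_incseq) (auto simp: Un incseq_def le_fun_def, meson order_less_le_trans)
  also have "\<dots> = (SUP k. \<integral>\<^sup>+y\<in>ball x (r k). F y \<partial>lborel)"
    by (simp add: emeasure_density)
  finally have "b < (SUP k. c * (\<integral>\<^sup>+y\<in>ball x (r k). F y \<partial>lborel))"
    using less by (simp add: SUP_mult_left_ennreal)
  then obtain k where "b < c * (\<integral>\<^sup>+y\<in>ball x (r k). F y \<partial>lborel)"
    by (auto simp: less_SUP_iff)
  then show ?thesis using that r by blast
qed

lemma open_less_set_nn_integral_ball:
  fixes F :: "'a::euclidean_space \<Rightarrow> ennreal"
  assumes F: "F \<in> borel_measurable borel" and s: "0 < s"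
  shows "open {x. b < c * (\<integral>\<^sup>+y\<in>ball x s. F y \<partial>lborel)}"
  unfolding open_dist
proof safe
  fix x assume "b < c * (\<integral>\<^sup>+y\<in>ball x s. F y \<partial>lborel)"
  then obtain q where q: "0 < q" "q < s" "b < c * (\<integral>\<^sup>+y\<in>ball x q. F y \<partial>lborel)"
    using less_set_nn_integral_ball[OF F s] by blast
  show "\<exists>e>0. \<forall>y. dist y x < e \<longrightarrow> y \<in> {x. b < c * (\<integral>\<^sup>+y\<in>ball x s. F y \<partial>lborel)}"
  proof (intro exI[of _ "s - q"] conjI allI impI CollectI)
    fix y assume "dist y x < s - q"
    then have "ball x q \<subseteq> ball y s"
      by (simp add: ball_subset_ball_iff dist_commute)
    then have "(\<integral>\<^sup>+z\<in>ball x q. F z \<partial>lborel) \<le> (\<integral>\<^sup>+z\<in>ball y s. F z \<partial>lborel)"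
      by (intro nn_integral_mono) (auto split: split_indicator)
    then show "b < c * (\<integral>\<^sup>+z\<in>ball y s. F z \<partial>lborel)"
      using q by (meson mult_left_mono order_less_le_trans zero_le)
  qed (use q in auto)
qed

lemma open_less_ball_max:
  assumes "F \<in> borel_measurable borel"
  shows "open {x. b < ball_max F x}"
proof -
  have "{x. b < ball_max F x}
      = (\<Union>s\<in>{0<..}. {x. b < ennreal (1 / s ^ DIM('a)) * (\<integral>\<^sup>+y\<in>ball x s. F y \<partial>lborel)})"
    by (auto simp: ball_max_def less_SUP_iff)
  also have "open \<dots>"
    using assms by (intro open_UN ballI open_less_set_nn_integral_ball) auto
  finally show ?thesis .
qed

lemma borel_measurable_ball_max [measurable (raw)]:
  "F \<in> borel_measurable borel \<Longrightarrow> ball_max F \<in> borel_measurable borel"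
  by (rule borel_measurableI_greater) (simp add: open_less_ball_max borel_open)

text \<open>The A_t condition on balls with the averages cleared of their denominators:
  \<open>(s powr t) ^ DIM('a)\<close> is \<open>|B|^t\<close> up to a power of the unit ball volume,
  which is absorbed in \<open>A\<close>.\<close>

definition muckenhoupt_ball ::
    "real \<Rightarrow> real \<Rightarrow> ('a::euclidean_space \<Rightarrow> ennreal) \<Rightarrow> bool" where
  "muckenhoupt_ball t A W \<longleftrightarrow> (\<forall>x. \<forall>s>0. (\<integral>\<^sup>+y\<in>ball x s. W y \<partial>lborel)
      * (\<integral>\<^sup>+y\<in>ball x s. W y epowr (- 1 / (t - 1)) \<partial>lborel) epowr (t - 1)
      \<le> ennreal (A * (s powr t) ^ DIM('a)))"

text \<open>Hoelder with exponents \<open>t\<close> and \<open>t / (t - 1)\<close> for the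
  factorisation of \<open>F\<close> into \<open>F * W^(1/t)\<close> and \<open>W^(-1/t)\<close>,
  raised to the power \<open>t\<close>. The two powers of \<open>W\<close> cancel because
  \<open>W\<close> is neither 0 nor \<open>top\<close>.\<close>

lemma epowr_set_nn_integral_le:
  assumes t: "1 < t" and [measurable]: "F \<in> borel_measurable M" "W \<in> borel_measurable M" "B \<in> sets M"
    and W: "\<And>x. 0 < W x" "\<And>x. W x < top"
  shows "(\<integral>\<^sup>+y\<in>B. F y \<partial>M) epowr t
      \<le> (\<integral>\<^sup>+y\<in>B. F y epowr t * W y \<partial>M) * (\<integral>\<^sup>+y\<in>B. W y epowr (- 1 / (t - 1)) \<partial>M) epowr (t - 1)"
proof -
  define q where "q = t / (t - 1)"
  have q: "1 < q" "1 / t + 1 / q = 1" "1 / q * t = t - 1" "- (q / t) = - 1 / (t - 1)"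
    using t by (auto simp: q_def field_simps)
  have WW: "W y epowr (1 / t) * W y epowr (- 1 / t) = 1" for y
    using W[of y] by (cases "W y" rule: epowr_cases)
       (auto simp: ennreal_epowr powr_minus simp flip: ennreal_mult powr_add)
  have "(\<integral>\<^sup>+y\<in>B. F y \<partial>M)
      = (\<integral>\<^sup>+y. (F y * W y epowr (1 / t) * indicator B y) * (W y epowr (- 1 / t) * indicator B y) \<partial>M)"
    by (intro nn_integral_cong)
       (use WW in \<open>auto split: split_indicator simp: mult.assoc\<close>)
  also have "\<dots> \<le> (\<integral>\<^sup>+y. (F y * W y epowr (1 / t) * indicator B y) epowr t \<partial>M) epowr (1 / t)
      * (\<integral>\<^sup>+y. (W y epowr (- 1 / t) * indicator B y) epowr q \<partial>M) epowr (1 / q)"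
    using t q by (intro nn_integral_Hoelder) auto
  also have "(\<integral>\<^sup>+y. (F y * W y epowr (1 / t) * indicator B y) epowr t \<partial>M) = (\<integral>\<^sup>+y\<in>B. F y epowr t * W y \<partial>M)"
    using t by (intro nn_integral_cong) (auto split: split_indicator simp: epowr_mult epowr_0_left epowr_epowr)
  also have "(\<integral>\<^sup>+y. (W y epowr (- 1 / t) * indicator B y) epowr q \<partial>M)
      = (\<integral>\<^sup>+y\<in>B. W y epowr (- 1 / (t - 1)) \<partial>M)"
    using t q by (intro nn_integral_cong) (auto split: split_indicator simp: epowr_0_left epowr_epowr)
  finally show ?thesis
    using t q epowr_mono[of t] by (force simp: epowr_mult epowr_epowr)
qed

text \<open>Multiplying by both integrals over the larger ball, instead of dividing by the dual one, means
  that no finiteness of either integral is needed.\<close>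

lemma muckenhoupt_ball_testing:
  fixes F W :: "'a::euclidean_space \<Rightarrow> ennreal"
  assumes t: "1 < t" and [measurable]: "F \<in> borel_measurable borel" "W \<in> borel_measurable borel"
    and W: "\<And>x. 0 < W x" "\<And>x. W x < top"
    and A: "muckenhoupt_ball t A W" "0 \<le> A" and s: "0 < s" and l: "0 < l"
    and less: "ennreal l < ennreal (1 / s ^ DIM('a)) * (\<integral>\<^sup>+y\<in>ball x s. F y \<partial>lborel)"
  shows "ennreal (l powr t) * (\<integral>\<^sup>+y\<in>ball x (5 * s). W y \<partial>lborel)
      \<le> ennreal (A * (5 powr t) ^ DIM('a)) * (\<integral>\<^sup>+y\<in>ball x s. F y epowr t * W y \<partial>lborel)"
proof -
  define c where "c = (s powr t) ^ DIM('a)"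
  have c: "0 < c" "c = (s ^ DIM('a)) powr t"
    using s by (auto simp: c_def powr_realpow[symmetric] powr_powr mult.commute)
  let ?w = "\<integral>\<^sup>+y\<in>ball x (5 * s). W y \<partial>lborel"
  let ?v = "\<lambda>s. (\<integral>\<^sup>+y\<in>ball x s. W y epowr (- 1 / (t - 1)) \<partial>lborel) epowr (t - 1)"
  let ?I = "\<integral>\<^sup>+y\<in>ball x s. F y epowr t * W y \<partial>lborel"
  have "ennreal (l powr t) \<le> ennreal (1 / c) * (\<integral>\<^sup>+y\<in>ball x s. F y \<partial>lborel) epowr t"
    using epowr_mono[OF _ less_imp_le[OF less], of t] t l s
    by (simp add: ennreal_epowr epowr_mult powr_divide c(2))
  also have "\<dots> \<le> ennreal (1 / c) * (?I * ?v s)"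
    using t W by (intro mult_left_mono epowr_set_nn_integral_le) auto
  \<comment> \<open>Only the dual integral is enlarged, to pair with the weight of the 5-fold ball.
    The integral of \<open>F\<close> stays on the small ball, since only the small balls will be
    disjoint.\<close>
  also have "\<dots> \<le> ennreal (1 / c) * (?I * ?v (5 * s))"
    using s t by (intro mult_left_mono epowr_mono nn_integral_mono) (auto split: split_indicator)
  finally have "ennreal (l powr t) * ?w \<le> ennreal (1 / c) * (?I * ?v (5 * s)) * ?w"
    by (rule mult_right_mono) simp
  also have "\<dots> = ennreal (1 / c) * ?I * (?w * ?v (5 * s))"
    by (simp add: mult_ac)
  also have "?w * ?v (5 * s) \<le> ennreal (A * ((5 * s) powr t) ^ DIM('a))"
    using A(1) s by (simp add: muckenhoupt_ball_def)
  finally have "ennreal (l powr t) * ?w \<le> ennreal (1 / c) * ?I * ennreal (A * ((5 * s) powr t) ^ DIM('a))"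
    by (simp add: mult_left_mono)
  also have "\<dots> = ennreal (1 / c * (A * ((5 * s) powr t) ^ DIM('a))) * ?I"
  proof -
    have "ennreal (1 / c * (A * ((5 * s) powr t) ^ DIM('a)))
        = ennreal (1 / c) * ennreal (A * ((5 * s) powr t) ^ DIM('a))"
      using A(2) c by (intro ennreal_mult) auto
    then show ?thesis by (simp only: mult_ac)
  qed
  also have "1 / c * (A * ((5 * s) powr t) ^ DIM('a)) = A * (5 powr t) ^ DIM('a)"
    using c(1) s by (simp add: c_def powr_mult power_mult_distrib)
  finally show ?thesis .
qed

text \<open>Each point of the level set is the centre of a ball to which
  \<open>muckenhoupt_ball_testing\<close> applies. Vitali selects disjoint ones whose 5-fold dilates
  still cover, and the right sides of the testing inequality, being integrals over disjoint balls,
  add up to at most the full integral.\<close>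

lemma ball_max_weak_type:
  fixes F W :: "'a::euclidean_space \<Rightarrow> ennreal"
  assumes t: "1 < t" and [measurable]: "F \<in> borel_measurable borel" "W \<in> borel_measurable borel"
    and W: "\<And>x. 0 < W x" "\<And>x. W x < top"
    and A: "muckenhoupt_ball t A W" "0 \<le> A" and l: "0 < l"
  shows "ennreal (l powr t) * emeasure (density lborel W) {x. ennreal l < ball_max F x}
      \<le> ennreal (A * (5 powr t) ^ DIM('a)) * (\<integral>\<^sup>+y. F y epowr t * W y \<partial>lborel)"
proof -
  define S where "S s = {x. ennreal l < ennreal (1 / s ^ DIM('a)) * (\<integral>\<^sup>+y\<in>ball x s. F y \<partial>lborel)}" for s
  \<comment> \<open>Vitali's lemma needs bounded radii, so the level set is exhausted by the open
    sets \<open>E N\<close>; the bound does not depend on \<open>N\<close>.\<close>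
  define E where "E N = (\<Union>s\<in>{0<..real N}. S s)" for N :: nat
  let ?w = "density lborel W"
  let ?R = "ennreal (A * (5 powr t) ^ DIM('a)) * (\<integral>\<^sup>+y. F y epowr t * W y \<partial>lborel)"
  have E_open: "open (E N)" for N
    unfolding E_def S_def by (intro open_UN ballI open_less_set_nn_integral_ball) auto
  have E_bound: "ennreal (l powr t) * emeasure ?w (E N) \<le> ?R" for N
  proof -
    have "\<forall>x\<in>E N. \<exists>s. 0 < s \<and> s \<le> real N \<and> x \<in> S s"
      by (auto simp: E_def)
    then obtain r where r: "\<And>x. x \<in> E N \<Longrightarrow> 0 < r x \<and> r x \<le> real N \<and> x \<in> S (r x)"
      by metis
    have "E N \<subseteq> (\<Union>x\<in>E N. ball x (r x))"
      using r by auto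
    then obtain C where C: "countable C" "C \<subseteq> E N"
      "pairwise (\<lambda>i j. disjnt (ball i (r i)) (ball j (r j))) C"
      "E N \<subseteq> (\<Union>i\<in>C. ball i (5 * r i))"
      by (rule Vitali_covering_lemma_balls[of "E N" "\<lambda>x. x" r "E N" "real N"]) (use r in auto)
    have "ennreal (l powr t) * emeasure ?w (E N)
        \<le> ennreal (l powr t) * emeasure ?w (\<Union>i\<in>C. ball i (5 * r i))"
      using C E_open by (intro mult_left_mono emeasure_mono) (auto intro!: sets.countable_UN' C)
    also have "\<dots> \<le> ennreal (l powr t) * (\<integral>\<^sup>+i. emeasure ?w (ball i (5 * r i)) \<partial>count_space C)"
      using C by (intro mult_left_mono emeasure_UN_le_nn_integral_count_space) auto
    also have "\<dots> = (\<integral>\<^sup>+i. ennreal (l powr t) * emeasure ?w (ball i (5 * r i)) \<partial>count_space C)"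
      by (simp add: nn_integral_cmult)
    also have "\<dots> \<le> (\<integral>\<^sup>+i. ennreal (A * (5 powr t) ^ DIM('a))
        * emeasure (density lborel (\<lambda>y. F y epowr t * W y)) (ball i (r i)) \<partial>count_space C)"
    proof (intro nn_integral_mono)
      fix i assume "i \<in> space (count_space C)"
      then have "i \<in> E N" using C by auto
      from r[OF this] show "ennreal (l powr t) * emeasure ?w (ball i (5 * r i))
          \<le> ennreal (A * (5 powr t) ^ DIM('a))
            * emeasure (density lborel (\<lambda>y. F y epowr t * W y)) (ball i (r i))"
        using muckenhoupt_ball_testing[OF t _ _ W A, of F "r i" l i] l by (auto simp: emeasure_density S_def)
    qed
    also have "\<dots> = ennreal (A * (5 powr t) ^ DIM('a))
        * (\<integral>\<^sup>+i. emeasure (density lborel (\<lambda>y. F y epowr t * W y)) (ball i (r i)) \<partial>count_space C)"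
      by (simp add: nn_integral_cmult)
    also have "(\<integral>\<^sup>+i. emeasure (density lborel (\<lambda>y. F y epowr t * W y)) (ball i (r i)) \<partial>count_space C)
        = emeasure (density lborel (\<lambda>y. F y epowr t * W y)) (\<Union>i\<in>C. ball i (r i))"
      using C(1,3) by (intro emeasure_UN_countable[symmetric])
        (auto simp: disjoint_family_on_def pairwise_def disjnt_def)
    also have "\<dots> \<le> emeasure (density lborel (\<lambda>y. F y epowr t * W y)) UNIV"
      by (intro emeasure_mono) auto
    also have "\<dots> = (\<integral>\<^sup>+y. F y epowr t * W y \<partial>lborel)"
      by (simp add: emeasure_density)
    finally show ?thesis
      by (meson mult_left_mono order_trans zero_le)
  qed
  have "{x. ennreal l < ball_max F x} = (\<Union>N. E N)"
  proof (intro equalityI subsetI)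
    fix x assume "x \<in> {x. ennreal l < ball_max F x}"
    then obtain s where s: "0 < s" "x \<in> S s"
      by (auto simp: ball_max_def less_SUP_iff S_def)
    moreover obtain N where "s \<le> real N"
      using real_arch_simple by blast
    ultimately show "x \<in> (\<Union>N. E N)"
      by (auto simp: E_def intro!: exI[of _ N] bexI[of _ s])
  next
    fix x assume "x \<in> (\<Union>N. E N)"
    then obtain s where "0 < s" "x \<in> S s"
      by (auto simp: E_def)
    then show "x \<in> {x. ennreal l < ball_max F x}"
      by (auto simp: ball_max_def less_SUP_iff S_def)
  qed
  moreover have "incseq E"
    unfolding incseq_def E_def by (intro allI impI UN_mono) auto
  ultimately have "emeasure ?w {x. ennreal l < ball_max F x} = (SUP N. emeasure ?w (E N))"
    using E_open by (simp add: SUP_emeasure_incseq image_subset_iff borel_open)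
  then show ?thesis
    using E_bound by (simp add: SUP_mult_left_ennreal SUP_least)
qed

subsection \<open>Marcinkiewicz interpolation\<close>

text \<open>The finite case is the integral of a power; for \<open>u = top\<close> the integral is
  bounded below by its truncations \<open>v powr a / a\<close>, which are unbounded.\<close>

lemma nn_integral_powr_less:
  assumes a: "0 < a"
  shows "(\<integral>\<^sup>+l. ennreal (l powr (a - 1)) * indicator {l. 0 < l \<and> ennreal l < u} l \<partial>lborel)
      = ennreal (1 / a) * u epowr a"
proof -
  have fin: "(\<integral>\<^sup>+l. ennreal (l powr (a - 1)) * indicator {0<..<v} l \<partial>lborel) = ennreal (v powr a / a)"
    if v: "0 < v" for v
  proof -
    have "(\<integral>\<^sup>+l. ennreal (l powr (a - 1)) * indicator {0<..<v} l \<partial>lborel)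
        = (\<integral>\<^sup>+l. ennreal (l powr (a - 1)) * indicator {0..v} l \<partial>lborel)"
      by (intro nn_integral_cong_AE, use AE_lborel_singleton[of 0] AE_lborel_singleton[of v] in eventually_elim)
         (auto split: split_indicator)
    also have "\<dots> = ennreal (v powr a / a)"
      using has_integral_powr_from_0[of "a - 1" v] a v
      by (intro nn_integral_has_integral_lebesgue') auto
    finally show ?thesis .
  qed
  show ?thesis
  proof (cases u rule: epowr_cases)
    case zero
    then show ?thesis using a by (simp add: epowr_0_left)
  next
    case (pos v)
    then have "{l. 0 < l \<and> ennreal l < u} = {0<..<v}"
      by (auto simp: ennreal_less_iff)
    then show ?thesis using a pos by (simp add: fin ennreal_epowr flip: ennreal_mult)
  next
    case top
    let ?I = "\<integral>\<^sup>+l. ennreal (l powr (a - 1)) * indicator {l. 0 < l \<and> ennreal l < u} l \<partial>lborel"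
    have ge: "ennreal (v powr a / a) \<le> ?I" if "0 < v" for v
      unfolding fin[OF that, symmetric] top by (intro nn_integral_mono) (auto split: split_indicator)
    have "?I = top"
    proof (rule ccontr)
      assume "?I \<noteq> top"
      then obtain r where r: "0 \<le> r" "?I = ennreal r"
        by (cases ?I) auto
      \<comment> \<open>The argument given to \<open>ge\<close> solves
        \<open>v powr a / a = r + 1\<close>.\<close>
      have "ennreal (r + 1) \<le> ?I"
        using ge[of "(a * (r + 1)) powr (1 / a)"] a r(1) by (simp add: powr_powr)
      then show False using r by simp
    qed
    then show ?thesis using a top by (simp add: epowr_top_left ennreal_mult_top)
  qed
qed

text \<open>The L^\<infinity> half of the interpolation. The part of \<open>F\<close> of height at
  most \<open>l / (2 * unit_ball_vol n)\<close> contributes at most \<open>l / 2\<close> to every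
  normalised integral, since the ball has volume \<open>unit_ball_vol n * s ^ n\<close>; the
  remaining part must account for more than \<open>l / 2\<close>.\<close>

lemma ball_max_truncate:
  fixes F :: "'a::euclidean_space \<Rightarrow> ennreal"
  assumes [measurable]: "F \<in> borel_measurable borel" and l: "0 < l"
    and less: "ennreal l < ball_max F x"
  shows "ennreal (l / 2) < ball_max (\<lambda>y. F y * indicator {y. ennreal (l / (2 * unit_ball_vol DIM('a))) < F y} y) x"
    (is "_ < ball_max ?G x")
proof -
  let ?c = "1 / (2 * unit_ball_vol DIM('a))"
  have G [measurable]: "F \<in> borel_measurable borel" "{y. ennreal (l / (2 * unit_ball_vol DIM('a))) < F y} \<in> sets borel"
    by measurable
  have om: "0 < unit_ball_vol DIM('a)"
    by simp
  have "ball_max F x \<le> ball_max ?G x + ennreal (l / 2)"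
    unfolding ball_max_def[of F]
  proof (rule SUP_least)
    fix s :: real assume "s \<in> {0<..}"
    then have s: "0 < s" by simp
    have "(\<integral>\<^sup>+y\<in>ball x s. F y \<partial>lborel)
        \<le> (\<integral>\<^sup>+y. ?G y * indicator (ball x s) y + ennreal (?c * l) * indicator (ball x s) y \<partial>lborel)"
      by (intro nn_integral_mono) (auto split: split_indicator simp: not_less)
    also have "\<dots> = (\<integral>\<^sup>+y\<in>ball x s. ?G y \<partial>lborel) + ennreal (?c * l) * emeasure lborel (ball x s)"
    proof -
      have "(\<integral>\<^sup>+y. ?G y * indicator (ball x s) y + ennreal (?c * l) * indicator (ball x s) y \<partial>lborel)
          = (\<integral>\<^sup>+y\<in>ball x s. ?G y \<partial>lborel) + (\<integral>\<^sup>+y\<in>ball x s. ennreal (?c * l) \<partial>lborel)"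
        by (rule nn_integral_add)
           (intro borel_measurable_times_ennreal borel_measurable_indicator borel_measurable_const; simp add: G)+
      also have "(\<integral>\<^sup>+y\<in>ball x s. ennreal (?c * l) \<partial>lborel) = ennreal (?c * l) * emeasure lborel (ball x s)"
        by (rule nn_integral_cmult_indicator) simp
      finally show ?thesis .
    qed
    also have "emeasure lborel (ball x s) = ennreal (unit_ball_vol DIM('a) * s ^ DIM('a))"
      using s by (simp add: emeasure_ball)
    also have "ennreal (?c * l) * \<dots> = ennreal (l / 2 * s ^ DIM('a))"
      using s l less_imp_neq[OF om, symmetric] by (simp flip: ennreal_mult)
    finally have "ennreal (1 / s ^ DIM('a)) * (\<integral>\<^sup>+y\<in>ball x s. F y \<partial>lborel)
        \<le> ennreal (1 / s ^ DIM('a)) * ((\<integral>\<^sup>+y\<in>ball x s. ?G y \<partial>lborel) + ennreal (l / 2 * s ^ DIM('a)))"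
      by (rule mult_left_mono) simp
    also have "\<dots> = ennreal (1 / s ^ DIM('a)) * (\<integral>\<^sup>+y\<in>ball x s. ?G y \<partial>lborel) + ennreal (l / 2)"
      using s l by (simp add: distrib_left flip: ennreal_mult)
    also have "\<dots> \<le> ball_max ?G x + ennreal (l / 2)"
      unfolding ball_max_def using s by (intro add_right_mono SUP_upper) auto
    finally show "ennreal (1 / s ^ DIM('a)) * (\<integral>\<^sup>+y\<in>ball x s. F y \<partial>lborel) \<le> ball_max ?G x + ennreal (l / 2)" .
  qed
  then have *: "ennreal l < ball_max ?G x + ennreal (l / 2)"
    using less by simp
  show ?thesis
  proof (rule ccontr)
    assume "\<not> ?thesis"
    then have "ball_max ?G x + ennreal (l / 2) \<le> ennreal (l / 2) + ennreal (l / 2)"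
      by (intro add_right_mono) simp
    also have "\<dots> = ennreal l"
      using l by (simp flip: ennreal_plus)
    finally show False using * by simp
  qed
qed

text \<open>Tonelli applied to \<open>nn_integral_powr_less\<close>. As \<open>W\<close> is
  arbitrary, the identity serves both for the weight and for the density \<open>F^t W\<close> in the
  interpolation.\<close>

lemma nn_integral_epowr_layer_cake:
  fixes U :: "'a::euclidean_space \<Rightarrow> ennreal"
  assumes [measurable]: "U \<in> borel_measurable borel" "W \<in> borel_measurable borel" and a: "0 < a"
  shows "ennreal (1 / a) * (\<integral>\<^sup>+x. U x epowr a * W x \<partial>lborel)
      = (\<integral>\<^sup>+l. ennreal (l powr (a - 1)) * indicator {0<..} l
          * emeasure (density lborel W) {x. ennreal l < U x} \<partial>lborel)"
proof -
  have "ennreal (1 / a) * (\<integral>\<^sup>+x. U x epowr a * W x \<partial>lborel)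
      = (\<integral>\<^sup>+x. ennreal (1 / a) * (U x epowr a * W x) \<partial>lborel)"
    by (simp add: nn_integral_cmult)
  also have "\<dots>
      = (\<integral>\<^sup>+x. (\<integral>\<^sup>+l. ennreal (l powr (a - 1)) * indicator {l. 0 < l \<and> ennreal l < U x} l * W x \<partial>lborel) \<partial>lborel)"
  proof (intro nn_integral_cong)
    fix x
    have "(\<integral>\<^sup>+l. ennreal (l powr (a - 1)) * indicator {l. 0 < l \<and> ennreal l < U x} l * W x \<partial>lborel)
        = (\<integral>\<^sup>+l. ennreal (l powr (a - 1)) * indicator {l. 0 < l \<and> ennreal l < U x} l \<partial>lborel) * W x"
      by (intro nn_integral_multc) measurable
    then show "ennreal (1 / a) * (U x epowr a * W x)
        = (\<integral>\<^sup>+l. ennreal (l powr (a - 1)) * indicator {l. 0 < l \<and> ennreal l < U x} l * W x \<partial>lborel)"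
      unfolding nn_integral_powr_less[OF a] by (simp only: mult.assoc)
  qed
  also have "\<dots> = (\<integral>\<^sup>+x. (\<integral>\<^sup>+l. ennreal (l powr (a - 1)) * indicator {0<..} l
        * (W x * (if ennreal l < U x then 1 else 0)) \<partial>lborel) \<partial>lborel)"
    by (intro nn_integral_cong) (auto split: split_indicator)
  also have "\<dots> = (\<integral>\<^sup>+l. (\<integral>\<^sup>+x. ennreal (l powr (a - 1)) * indicator {0<..} l
        * (W x * (if ennreal l < U x then 1 else 0)) \<partial>lborel) \<partial>lborel)"
    by (intro lborel_pair.Fubini') measurable
  also have "\<dots> = (\<integral>\<^sup>+l. ennreal (l powr (a - 1)) * indicator {0<..} l
          * emeasure (density lborel W) {x. ennreal l < U x} \<partial>lborel)"
    by (auto intro!: nn_integral_cong simp: nn_integral_cmult emeasure_density indicator_def of_bool_def)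
  finally show ?thesis .
qed

text \<open>The weight enters only through the weak type bound at \<open>t\<close>, once for each
  level, so the constant stays linear in \<open>A\<close>. Its other factors:
  \<open>2 powr t\<close> from halving the level, \<open>(5 powr t) ^ DIM('a)\<close> from the
  Vitali dilation, \<open>(2 * unit_ball_vol DIM('a)) powr (q - t)\<close> from the truncation
  height, \<open>q\<close> and \<open>1 / (q - t)\<close> from the two layer cake integrals.\<close>

lemma ball_max_strong_type:
  fixes F W :: "'a::euclidean_space \<Rightarrow> ennreal"
  assumes t: "1 < t" "t < q" and [measurable]: "F \<in> borel_measurable borel" "W \<in> borel_measurable borel"
    and W: "\<And>x. 0 < W x" "\<And>x. W x < top"
    and A: "muckenhoupt_ball t A W" "0 \<le> A"
  shows "(\<integral>\<^sup>+x. ball_max F x epowr q * W x \<partial>lborel)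
      \<le> ennreal (q / (q - t) * 2 powr t * (5 powr t) ^ DIM('a) * (2 * unit_ball_vol DIM('a)) powr (q - t) * A)
         * (\<integral>\<^sup>+x. F x epowr q * W x \<partial>lborel)"
proof -
  define c where "c = 2 * unit_ball_vol (real DIM('a))"
  have c: "0 < c" by (simp add: c_def)
  define B where "B = 2 powr t * (A * (5 powr t) ^ DIM('a))"
  have B: "0 \<le> B" using A(2) by (simp add: B_def)
  define G where "G l y = F y * indicator {y. ennreal (l / c) < F y} y" for l y
  have [measurable]: "G l \<in> borel_measurable borel" for l
    unfolding G_def by measurable
  have less_iff: "ennreal (l / c) < F x \<longleftrightarrow> ennreal l < ennreal c * F x" if "0 < l" for l x
    using that c by (cases "F x") (auto simp: ennreal_less_iff divide_less_eq mult.commute ennreal_mult_top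
        simp flip: ennreal_mult)
  \<comment> \<open>Weak type for \<open>G l\<close> at level \<open>l / 2\<close>. The integral of
    \<open>G l\<close> to the power \<open>t\<close> is the \<open>F^t W\<close> measure of a
    superlevel set of \<open>c * F\<close>, so the bound is again a layer cake integrand, now with
    exponent \<open>q - t\<close>, and can be read backwards.\<close>
  have weak: "ennreal (l powr (q - 1)) * emeasure (density lborel W) {x. ennreal l < ball_max F x}
      \<le> ennreal B * (ennreal (l powr (q - t - 1))
         * emeasure (density lborel (\<lambda>x. F x epowr t * W x)) {x. ennreal l < ennreal c * F x})"
    if l: "0 < l" for l
  proof -
    have "emeasure (density lborel W) {x. ennreal l < ball_max F x}
        \<le> emeasure (density lborel W) {x. ennreal (l / 2) < ball_max (G l) x}"
      using ball_max_truncate[of F l] l unfolding G_def[abs_def] c_def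
      by (intro emeasure_mono) auto
    then have "ennreal (l powr (q - 1)) * emeasure (density lborel W) {x. ennreal l < ball_max F x}
        \<le> ennreal (l powr (q - 1)) * emeasure (density lborel W) {x. ennreal (l / 2) < ball_max (G l) x}"
      by (rule mult_left_mono) simp
    also have "\<dots> = ennreal (2 powr t * l powr (q - t - 1)) * ennreal ((l / 2) powr t)
        * emeasure (density lborel W) {x. ennreal (l / 2) < ball_max (G l) x}"
      using l by (simp add: powr_divide flip: ennreal_mult powr_add)
    also have "\<dots> \<le> ennreal (2 powr t * l powr (q - t - 1))
          * (ennreal (A * (5 powr t) ^ DIM('a)) * (\<integral>\<^sup>+y. G l y epowr t * W y \<partial>lborel))"
      unfolding mult.assoc using t W A l by (intro mult_left_mono ball_max_weak_type) auto
    also have "(\<integral>\<^sup>+y. G l y epowr t * W y \<partial>lborel)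
        = emeasure (density lborel (\<lambda>x. F x epowr t * W x)) {x. ennreal l < ennreal c * F x}"
      using t by (auto simp: emeasure_density G_def less_iff[OF l] epowr_0_left intro!: nn_integral_cong
           split: split_indicator)
    also have "ennreal (2 powr t * l powr (q - t - 1)) * (ennreal (A * (5 powr t) ^ DIM('a)) * \<dots>)
        = ennreal B * (ennreal (l powr (q - t - 1)) * \<dots>)"
      using A(2) by (simp add: B_def ennreal_mult mult_ac)
    finally show ?thesis .
  qed
  have "ennreal (1 / q) * (\<integral>\<^sup>+x. ball_max F x epowr q * W x \<partial>lborel)
      = (\<integral>\<^sup>+l. ennreal (l powr (q - 1)) * indicator {0<..} l
          * emeasure (density lborel W) {x. ennreal l < ball_max F x} \<partial>lborel)"
    using t by (intro nn_integral_epowr_layer_cake) auto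
  also have "\<dots> \<le> (\<integral>\<^sup>+l. ennreal B * (ennreal (l powr (q - t - 1)) * indicator {0<..} l
          * emeasure (density lborel (\<lambda>x. F x epowr t * W x)) {x. ennreal l < ennreal c * F x}) \<partial>lborel)"
    by (intro nn_integral_mono) (use weak in \<open>auto split: split_indicator\<close>)
  also have "\<dots> = ennreal B * (\<integral>\<^sup>+l. ennreal (l powr (q - t - 1)) * indicator {0<..} l
          * emeasure (density lborel (\<lambda>x. F x epowr t * W x)) {x. ennreal l < ennreal c * F x} \<partial>lborel)"
    by (intro nn_integral_cmult) (simp add: emeasure_density)
  also have "(\<integral>\<^sup>+l. ennreal (l powr (q - t - 1)) * indicator {0<..} l
          * emeasure (density lborel (\<lambda>x. F x epowr t * W x)) {x. ennreal l < ennreal c * F x} \<partial>lborel)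
      = ennreal (1 / (q - t)) * (\<integral>\<^sup>+x. (ennreal c * F x) epowr (q - t) * (F x epowr t * W x) \<partial>lborel)"
    using t by (intro nn_integral_epowr_layer_cake[symmetric]) auto
  also have "(\<integral>\<^sup>+x. (ennreal c * F x) epowr (q - t) * (F x epowr t * W x) \<partial>lborel)
      = (\<integral>\<^sup>+x. ennreal (c powr (q - t)) * (F x epowr q * W x) \<partial>lborel)"
    using t c epowr_add[of "q - t" t] by (intro nn_integral_cong) (simp add: epowr_mult ennreal_epowr mult_ac)
  also have "\<dots> = ennreal (c powr (q - t)) * (\<integral>\<^sup>+x. F x epowr q * W x \<partial>lborel)"
    by (simp add: nn_integral_cmult)
  finally have "ennreal q * (ennreal (1 / q) * (\<integral>\<^sup>+x. ball_max F x epowr q * W x \<partial>lborel))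
     \<le> ennreal q * (ennreal B * (ennreal (1 / (q - t)) * (ennreal (c powr (q - t)) * (\<integral>\<^sup>+x. F x epowr q * W x \<partial>lborel))))"
    by (rule mult_left_mono) simp
  also have "\<dots> = ennreal (q * (B * (1 / (q - t) * c powr (q - t)))) * (\<integral>\<^sup>+x. F x epowr q * W x \<partial>lborel)"
    using t B by (simp add: mult.assoc[symmetric] flip: ennreal_mult)
  also have "q * (B * (1 / (q - t) * c powr (q - t)))
      = q / (q - t) * 2 powr t * (5 powr t) ^ DIM('a) * c powr (q - t) * A"
    by (simp add: B_def)
  also have "ennreal q * (ennreal (1 / q) * (\<integral>\<^sup>+x. ball_max F x epowr q * W x \<partial>lborel))
      = (\<integral>\<^sup>+x. ball_max F x epowr q * W x \<partial>lborel)"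
    using t by (simp add: mult.assoc[symmetric] flip: ennreal_mult)
  finally show ?thesis unfolding c_def .
qed

section \<open>Null sets, reflections and rational radii\<close>

text \<open>Lets \<open>maximal_op H f\<close> inherit measurability from a Borel function that
  equals it only almost everywhere: the disagreement lies in a null set, all of whose subsets are
  measurable for the completion.\<close>

lemma measurable_completion_cong_AE:
  assumes f: "f \<in> M \<rightarrow>\<^sub>M N" and ae: "AE x in M. f x = g x" and g: "g \<in> space M \<rightarrow> space N"
  shows "g \<in> completion M \<rightarrow>\<^sub>M N"
proof (rule measurableI)
  obtain Z where Z: "Z \<in> null_sets M" "{x \<in> space M. f x \<noteq> g x} \<subseteq> Z"
    using ae by (auto simp: eventually_ae_filter)
  fix A assume "A \<in> sets N"
  then have "f -` A \<inter> space M - Z \<in> sets (completion M)"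
    using f Z by (intro sets_completionI_sets) auto
  moreover have "g -` A \<inter> space M \<inter> Z \<in> sets (completion M)"
    using Z by (intro null_sets_completion[OF Z(1)]) auto
  ultimately have "(f -` A \<inter> space M - Z) \<union> (g -` A \<inter> space M \<inter> Z) \<in> sets (completion M)"
    by (rule sets.Un)
  also have "(f -` A \<inter> space M - Z) \<union> (g -` A \<inter> space M \<inter> Z) = g -` A \<inter> space (completion M)"
    using Z(2) by auto
  finally show "g -` A \<inter> space (completion M) \<in> sets (completion M)" .
qed (use g in auto)

lemma lborel_eq_distr_diff: "lborel = distr lborel borel (\<lambda>y. x - y :: 'a::euclidean_space)"
  using lborel_affine[of "-1" x] by (simp add: density_1)

lemma nn_integral_lborel_diff:
  fixes g :: "'a::euclidean_space \<Rightarrow> ennreal"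
  assumes [measurable]: "g \<in> borel_measurable borel"
  shows "(\<integral>\<^sup>+y. g (x - y) \<partial>lborel) = (\<integral>\<^sup>+z. g z \<partial>lborel)"
  by (subst (2) lborel_eq_distr_diff[of x]) (simp add: nn_integral_distr)

lemma AE_lborel_diff:
  fixes x :: "'a::euclidean_space"
  assumes "AE z in lborel. P z"
  shows "AE y in lborel. P (x - y)"
proof -
  have "AE z in distr lborel borel (\<lambda>y. x - y). P z"
    using assms by (subst lborel_eq_distr_diff[of x, symmetric])
  then show ?thesis
    by (rule AE_distrD[rotated]) simp
qed

lemma set_nn_integral_lborel_diff:
  fixes g :: "'a::euclidean_space \<Rightarrow> ennreal"
  assumes [measurable]: "g \<in> borel_measurable borel"
  shows "(\<integral>\<^sup>+y\<in>ball 0 s. g (x - y) \<partial>lborel) = (\<integral>\<^sup>+z\<in>ball x s. g z \<partial>lborel)"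
proof -
  have "(\<integral>\<^sup>+y\<in>ball 0 s. g (x - y) \<partial>lborel) = (\<integral>\<^sup>+y. g (x - y) * indicator (ball x s) (x - y) \<partial>lborel)"
    by (intro nn_integral_cong) (auto simp: indicator_def dist_norm)
  also have "\<dots> = (\<integral>\<^sup>+z\<in>ball x s. g z \<partial>lborel)"
    by (intro nn_integral_lborel_diff borel_measurable_times_ennreal borel_measurable_indicator) simp_all
  finally show ?thesis .
qed

text \<open>Makes the supremum countable, for measurability in the centre. The normalised integral
  is not monotone in \<open>s\<close>, but once the ball is shrunk slightly to radius
  \<open>q\<close>, any rational \<open>u\<close> between \<open>q\<close> and \<open>s\<close> will
  do: its ball contains the shrunk one, and \<open>1 / u ^ n\<close> is at least
  \<open>1 / s ^ n\<close>.\<close>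

lemma SUP_ball_eq_SUP_rat:
  fixes G :: "'a::euclidean_space \<Rightarrow> ennreal"
  assumes G: "G \<in> borel_measurable borel"
  shows "(SUP s\<in>{0<..}. ennreal (1 / s ^ n) * (\<integral>\<^sup>+y\<in>ball x s. G y \<partial>lborel))
      = (SUP s\<in>{0<..} \<inter> \<rat>. ennreal (1 / s ^ n) * (\<integral>\<^sup>+y\<in>ball x s. G y \<partial>lborel))"
    (is "?L = ?R")
proof (rule antisym)
  show "?L \<le> ?R"
  proof (rule SUP_least, rule dense_le)
    fix s :: real and b assume "s \<in> {0<..}"
      and b: "b < ennreal (1 / s ^ n) * (\<integral>\<^sup>+y\<in>ball x s. G y \<partial>lborel)"
    then have s: "0 < s" by simp
    from less_set_nn_integral_ball[OF G s b] obtain q where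
      q: "0 < q" "q < s" "b < ennreal (1 / s ^ n) * (\<integral>\<^sup>+y\<in>ball x q. G y \<partial>lborel)" .
    obtain u where u: "u \<in> \<rat>" "q < u" "u < s"
      using Rats_dense_in_real[OF q(2)] by blast
    note q(3)
    also have "ennreal (1 / s ^ n) * (\<integral>\<^sup>+y\<in>ball x q. G y \<partial>lborel)
        \<le> ennreal (1 / u ^ n) * (\<integral>\<^sup>+y\<in>ball x u. G y \<partial>lborel)"
      using q u s by (intro mult_mono ennreal_leI nn_integral_mono divide_left_mono power_mono mult_pos_pos)
        (auto split: split_indicator)
    also have "\<dots> \<le> ?R"
      using q u by (intro SUP_upper) auto
    finally show "b \<le> ?R" by simp
  qed
qed (intro SUP_subset_mono, auto)

subsection \<open>Muckenhoupt weights\<close>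

lemma emeasure_cube:
  fixes a :: "real ^ 'n"
  assumes "0 \<le> l"
  shows "emeasure lebesgue (cbox a (a + vec l)) = ennreal (l ^ CARD('n))"
proof -
  have "cbox a (a + vec l) \<noteq> {}"
    using assms by (simp add: interval_ne_empty_cart)
  then have "measure lborel (cbox a (a + vec l)) = l ^ CARD('n)"
    by (simp add: content_cbox_cart)
  moreover have "emeasure lborel (cbox a (a + vec l)) = ennreal (measure lborel (cbox a (a + vec l)))"
    by (intro emeasure_eq_ennreal_measure) (simp add: emeasure_lborel_cbox_eq)
  ultimately show ?thesis by simp
qed

lemma set_nn_integral_cube:
  fixes a :: "real ^ 'n"
  assumes "0 < l"
  shows "(\<integral>\<^sup>+x\<in>cbox a (a + vec l). g x \<partial>lebesgue) = average (cbox a (a + vec l)) g * ennreal (l ^ CARD('n))"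
  unfolding average_def emeasure_cube[OF less_imp_le[OF assms]] divide_ennreal_def
  using assms by (simp add: mult.assoc inverse_ennreal flip: ennreal_mult)

text \<open>The p-th root of the A_t condition with constant \<open>K powr p\<close>. For
  \<open>t = 1 + (p - 1) / r\<close> it is the hypothesis on the weight in the theorem.\<close>

definition muckenhoupt :: "real \<Rightarrow> real \<Rightarrow> real \<Rightarrow> (real ^ 'n \<Rightarrow> ennreal) \<Rightarrow> bool" where
  "muckenhoupt p t K w \<longleftrightarrow> (\<forall>Q\<in>cubes. average Q w epowr (1 / p) *
     average Q (\<lambda>x. w x epowr (- 1 / (t - 1))) epowr ((t - 1) / p) \<le> ennreal K)"

lemma ball_subset_cube:
  fixes x :: "real ^ 'n"
  shows "ball x s \<subseteq> cbox (x - vec s) (x - vec s + vec (2 * s))"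
proof
  fix y assume "y \<in> ball x s"
  then have "\<bar>(x - y) $ i\<bar> < s" for i
    using component_le_norm_cart[of "x - y" i] by (simp add: dist_norm)
  then have "\<bar>x $ i - y $ i\<bar> < s" for i
    by simp
  then show "y \<in> cbox (x - vec s) (x - vec s + vec (2 * s))"
    by (simp add: mem_box_cart abs_less_iff) (metis (no_types) add.commute diff_less_eq less_eq_real_def)
qed

text \<open>A ball of radius \<open>s\<close> lies in a cube of side \<open>2 * s\<close>, so
  passing to the cube enlarges both integrals. Clearing the two averages costs
  \<open>|Q| * |Q|^(t - 1) = |Q|^t\<close>, the source of
  \<open>(2 powr t) ^ CARD('n)\<close>.\<close>

lemma muckenhoupt_imp_muckenhoupt_ball:
  fixes w W :: "real ^ 'n \<Rightarrow> ennreal"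
  assumes p: "1 < p" and t: "1 < t" and K: "0 < K" and w: "muckenhoupt p t K w"
    and ae: "AE x in lborel. w x = W x"
  shows "muckenhoupt_ball t (K powr p * (2 powr t) ^ CARD('n)) W"
  unfolding muckenhoupt_ball_def
proof (intro allI impI)
  fix x :: "real ^ 'n" and s :: real assume s: "0 < s"
  define Q where "Q = cbox (x - vec s) (x - vec s + vec (2 * s))"
  define m where "m = (2 * s) ^ CARD('n)"
  have m: "0 < m" using s by (simp add: m_def)
  have Q: "Q \<in> cubes" unfolding Q_def cubes_def using s by (intro CollectI exI[of _ "x - vec s"] exI[of _ "2 * s"]) auto
  \<comment> \<open>Stated for every \<open>g\<close>, to serve for the weight itself and for its
    dual power.\<close>
  have int: "(\<integral>\<^sup>+y\<in>ball x s. g (W y) \<partial>lborel) \<le> average Q (\<lambda>x. g (w x)) * ennreal m" for g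
  proof -
    have "(\<integral>\<^sup>+y\<in>ball x s. g (W y) \<partial>lborel) = (\<integral>\<^sup>+y\<in>ball x s. g (w y) \<partial>lborel)"
      by (intro nn_integral_cong_AE, use ae in eventually_elim) simp
    also have "\<dots> \<le> (\<integral>\<^sup>+y\<in>Q. g (w y) \<partial>lborel)"
      using ball_subset_cube[of x s] unfolding Q_def
      by (intro nn_integral_mono) (auto split: split_indicator)
    also have "\<dots> = average Q (\<lambda>x. g (w x)) * ennreal m"
      using set_nn_integral_cube[of "2 * s" "\<lambda>x. g (w x)" "x - vec s"] s
      by (simp add: nn_integral_completion Q_def m_def)
    finally show ?thesis .
  qed
  let ?w = "average Q w" and ?v = "average Q (\<lambda>x. w x epowr (- 1 / (t - 1)))"
  have "?w epowr (1 / p) * ?v epowr ((t - 1) / p) \<le> ennreal K"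
    using w Q by (simp add: muckenhoupt_def)
  then have "(?w epowr (1 / p) * ?v epowr ((t - 1) / p)) epowr p \<le> ennreal K epowr p"
    using p by (intro epowr_mono) auto
  then have *: "?w * ?v epowr (t - 1) \<le> ennreal (K powr p)"
    using p K by (simp add: epowr_mult epowr_epowr ennreal_epowr)
  have "(\<integral>\<^sup>+y\<in>ball x s. W y \<partial>lborel) * (\<integral>\<^sup>+y\<in>ball x s. W y epowr (- 1 / (t - 1)) \<partial>lborel) epowr (t - 1)
      \<le> (?w * ennreal m) * (?v * ennreal m) epowr (t - 1)"
    using int[of "\<lambda>a. a"] int[of "\<lambda>a. a epowr (- 1 / (t - 1))"] t
    by (intro mult_mono epowr_mono) auto
  also have "\<dots> = (?w * ?v epowr (t - 1)) * (ennreal m * ennreal (m powr (t - 1)))"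
    using t m by (simp add: epowr_mult ennreal_epowr mult_ac)
  also have "ennreal m * ennreal (m powr (t - 1)) = ennreal (m powr t)"
    using m powr_add[of m 1 "t - 1"] by (simp flip: ennreal_mult)
  also have "(?w * ?v epowr (t - 1)) * ennreal (m powr t) \<le> ennreal (K powr p) * ennreal (m powr t)"
    by (intro mult_right_mono *) simp
  also have "\<dots> = ennreal (K powr p * (2 powr t) ^ CARD('n) * (s powr t) ^ CARD('n))"
    using s by (simp add: m_def power_mult_distrib powr_mult powr_power[symmetric] ennreal_mult[symmetric] powr_powr powr_realpow[symmetric] mult.commute mult.left_commute)
  finally show "(\<integral>\<^sup>+y\<in>ball x s. W y \<partial>lborel) * (\<integral>\<^sup>+y\<in>ball x s. W y epowr (- 1 / (t - 1)) \<partial>lborel) epowr (t - 1)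
      \<le> ennreal (K powr p * (2 powr t) ^ CARD('n) * (s powr t) ^ DIM(real ^ 'n))"
    by simp
qed

text \<open>The alternative might vary with \<open>k\<close>. But if \<open>R\<close> fails on some
  \<open>C j\<close>, it fails on every larger set, so \<open>P\<close> holds on all of these, and
  they exhaust the space.\<close>

lemma AE_exhausting_dichotomy:
  fixes C :: "nat \<Rightarrow> 'a set"
  assumes C: "incseq C" "(\<Union>k. C k) = UNIV"
    and PR: "\<And>k. (AE x in M. x \<in> C k \<longrightarrow> P x) \<or> (AE x in M. x \<in> C k \<longrightarrow> R x)"
  shows "(AE x in M. P x) \<or> (AE x in M. R x)"
proof (rule disjCI)
  assume not: "\<not> (AE x in M. R x)"
  have all: "AE x in M. S x" if "\<And>k. AE x in M. x \<in> C k \<longrightarrow> S x" for S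
  proof -
    have "AE x in M. \<forall>k. x \<in> C k \<longrightarrow> S x"
      unfolding AE_all_countable using that by blast
    then show ?thesis
      by (rule eventually_mono) (use C(2) in auto)
  qed
  obtain j where j: "\<not> (AE x in M. x \<in> C j \<longrightarrow> R x)"
    using all not by blast
  show "AE x in M. P x"
  proof (rule all)
    fix k
    have "\<not> (AE x in M. x \<in> C (max j k) \<longrightarrow> R x)"
    proof
      assume "AE x in M. x \<in> C (max j k) \<longrightarrow> R x"
      moreover have "C j \<subseteq> C (max j k)" using C(1) by (simp add: incseqD)
      ultimately have "AE x in M. x \<in> C j \<longrightarrow> R x" by (auto elim!: eventually_mono)
      then show False using j by simp
    qed
    then have "AE x in M. x \<in> C (max j k) \<longrightarrow> P x" using PR by blast
    moreover have "C k \<subseteq> C (max j k)" using C(1) by (simp add: incseqD)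
    ultimately show "AE x in M. x \<in> C k \<longrightarrow> P x" by (auto elim!: eventually_mono)
  qed
qed

lemma set_nn_integral_eq_0_AE:
  "g \<in> borel_measurable M \<Longrightarrow> A \<in> sets M \<Longrightarrow> (\<integral>\<^sup>+x\<in>A. g x \<partial>M) = 0 \<Longrightarrow> AE x in M. x \<in> A \<longrightarrow> g x = 0"
  by (subst (asm) nn_integral_0_iff_AE) (auto elim!: eventually_mono split: split_indicator_asm)

lemma set_nn_integral_finite_AE:
  assumes "g \<in> borel_measurable M" "A \<in> sets M" "(\<integral>\<^sup>+x\<in>A. g x \<partial>M) \<noteq> (top :: ennreal)"
  shows "AE x in M. x \<in> A \<longrightarrow> g x \<noteq> top"
proof -
  have "AE x in M. g x * indicator A x \<noteq> \<infinity>"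
    using assms by (intro nn_integral_PInf_AE) auto
  then show ?thesis by eventually_elim (auto split: split_indicator_asm)
qed

text \<open>The degenerate weights \<open>0\<close> and \<open>\<infinity>\<close> satisfy the condition because \<open>0 * \<infinity> = 0\<close>.\<close>

lemma muckenhoupt_trichotomy:
  fixes w :: "real ^ 'n \<Rightarrow> ennreal"
  assumes p: "1 < p" and t: "1 < t" and w: "muckenhoupt p t K w"
    and [measurable]: "w \<in> borel_measurable lebesgue"
  shows "(AE x in lebesgue. w x = 0) \<or> (AE x in lebesgue. w x = top) \<or> (AE x in lebesgue. 0 < w x \<and> w x < top)"
proof -
  define C :: "nat \<Rightarrow> (real ^ 'n) set" where
    "C k = cbox (- vec (real (k + 1))) (- vec (real (k + 1)) + vec (2 * real (k + 1)))" for k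
  have C_iff: "x \<in> C k \<longleftrightarrow> (\<forall>i. \<bar>x $ i\<bar> \<le> real (k + 1))" for x k
    unfolding C_def mem_box_cart abs_le_iff by (simp add: algebra_simps) (smt (verit))
  have inc: "incseq C"
    unfolding incseq_def by (fastforce simp: C_iff intro: order_trans)
  have Un: "(\<Union>k. C k) = UNIV"
  proof (intro equalityI subsetI UNIV_I)
    fix x :: "real ^ 'n"
    obtain k where k: "norm x \<le> real k" using real_arch_simple by blast
    have "\<bar>x $ i\<bar> \<le> real (k + 1)" for i
      using component_le_norm_cart[of x i] k by simp
    then show "x \<in> (\<Union>k. C k)" by (auto simp: C_iff)
  qed
  let ?v = "\<lambda>x. w x epowr (- 1 / (t - 1))"
  have [measurable]: "C k \<in> sets lebesgue" for k
    unfolding C_def by simp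
  have vneg: "- 1 / (t - 1) < 0" using t by simp
  \<comment> \<open>The product of averages is finite, so one factor can be infinite only if the
    other is 0.\<close>
  have prod: "(\<integral>\<^sup>+x\<in>C k. w x \<partial>lebesgue) = 0 \<or> (\<integral>\<^sup>+x\<in>C k. ?v x \<partial>lebesgue) \<noteq> top"
    "(\<integral>\<^sup>+x\<in>C k. ?v x \<partial>lebesgue) = 0 \<or> (\<integral>\<^sup>+x\<in>C k. w x \<partial>lebesgue) \<noteq> top" for k
  proof -
    define l where "l = 2 * real (k + 1)"
    have l: "0 < l" "0 < l ^ CARD('n)" by (simp_all add: l_def)
    have Ck: "C k = cbox (- vec (real (k + 1))) (- vec (real (k + 1)) + vec l)"
      by (simp add: C_def l_def)
    have "C k \<in> cubes" using l unfolding Ck cubes_def by blast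
    then have "average (C k) w epowr (1 / p) * average (C k) ?v epowr ((t - 1) / p) \<le> ennreal K"
      using w by (simp add: muckenhoupt_def)
    then have "average (C k) w epowr (1 / p) * average (C k) ?v epowr ((t - 1) / p) < top"
      by (rule order_le_less_trans) simp
    then have "average (C k) w = 0 \<or> average (C k) ?v \<noteq> top"
      "average (C k) ?v = 0 \<or> average (C k) w \<noteq> top"
      using p t by (auto simp: epowr_top_left ennreal_mult_top ennreal_top_mult epowr_eq_0_iff split: if_splits)
    then show "(\<integral>\<^sup>+x\<in>C k. w x \<partial>lebesgue) = 0 \<or> (\<integral>\<^sup>+x\<in>C k. ?v x \<partial>lebesgue) \<noteq> top"
      "(\<integral>\<^sup>+x\<in>C k. ?v x \<partial>lebesgue) = 0 \<or> (\<integral>\<^sup>+x\<in>C k. w x \<partial>lebesgue) \<noteq> top"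
      unfolding Ck set_nn_integral_cube[OF l(1)] using l by (auto simp: ennreal_mult_eq_top_iff)
  qed
  \<comment> \<open>On a single cube a zero integral of \<open>w\<close> gives \<open>w = 0\<close>,
    while a finite dual integral excludes \<open>w = 0\<close>, where the negative power is
    \<open>top\<close>. The second dichotomy exchanges the roles of \<open>w\<close> and its dual
    power.\<close>
  have "(AE x in lebesgue. w x = 0) \<or> (AE x in lebesgue. w x \<noteq> 0)"
  proof (rule AE_exhausting_dichotomy[OF inc Un])
    fix k
    from prod(1)[of k] show "(AE x in lebesgue. x \<in> C k \<longrightarrow> w x = 0) \<or> (AE x in lebesgue. x \<in> C k \<longrightarrow> w x \<noteq> 0)"
    proof
      assume "(\<integral>\<^sup>+x\<in>C k. w x \<partial>lebesgue) = 0"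
      then show ?thesis by (intro disjI1 set_nn_integral_eq_0_AE) auto
    next
      assume "(\<integral>\<^sup>+x\<in>C k. ?v x \<partial>lebesgue) \<noteq> top"
      then have "AE x in lebesgue. x \<in> C k \<longrightarrow> ?v x \<noteq> top"
        by (intro set_nn_integral_finite_AE) measurable
      then have "AE x in lebesgue. x \<in> C k \<longrightarrow> w x \<noteq> 0"
        by eventually_elim (use vneg in \<open>auto simp: epowr_def\<close>)
      then show ?thesis ..
    qed
  qed
  moreover have "(AE x in lebesgue. w x = top) \<or> (AE x in lebesgue. w x \<noteq> top)"
  proof (rule AE_exhausting_dichotomy[OF inc Un])
    fix k
    from prod(2)[of k] show "(AE x in lebesgue. x \<in> C k \<longrightarrow> w x = top) \<or> (AE x in lebesgue. x \<in> C k \<longrightarrow> w x \<noteq> top)"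
    proof
      assume "(\<integral>\<^sup>+x\<in>C k. w x \<partial>lebesgue) \<noteq> top"
      then show ?thesis by (intro disjI2 set_nn_integral_finite_AE) auto
    next
      assume "(\<integral>\<^sup>+x\<in>C k. ?v x \<partial>lebesgue) = 0"
      then have "AE x in lebesgue. x \<in> C k \<longrightarrow> ?v x = 0"
        by (intro set_nn_integral_eq_0_AE) measurable
      then have "AE x in lebesgue. x \<in> C k \<longrightarrow> w x = top"
      proof eventually_elim
        case (elim x)
        then show ?case
          using vneg by (cases "w x" rule: epowr_cases) (auto simp: epowr_def)
      qed
      then show ?thesis ..
    qed
  qed
  moreover have "AE x in lebesgue. 0 < w x \<and> w x < top"
    if "AE x in lebesgue. w x \<noteq> 0" "AE x in lebesgue. w x \<noteq> top"
    using that by eventually_elim (auto simp: less_top zero_less_iff_neq_zero)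
  ultimately show ?thesis by blast
qed

subsection \<open>The maximal operator with kernel\<close>

text \<open>The null set where \<open>H\<close> and its Borel representative differ has null
  sections only at almost every \<open>x\<close>. This is why the pointwise estimate of
  \<open>maximal_op\<close> holds for almost every \<open>x\<close>.\<close>

lemma lebesgue_prod_ex_borel_sections:
  fixes H :: "'a::euclidean_space \<times> 'b::euclidean_space \<Rightarrow> ennreal"
  assumes "H \<in> borel_measurable lebesgue"
  obtains H' where "H' \<in> borel_measurable borel" "AE x in lborel. AE y in lborel. H (x, y) = H' (x, y)"
proof -
  obtain H' where H': "H' \<in> borel_measurable lborel" "AE z in lborel. H z = H' z"
    using completion_ex_borel_measurable[OF assms] by blast
  then have "AE z in lborel \<Otimes>\<^sub>M lborel. H z = H' z"
    by (subst lborel_prod)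
  then have "AE x in lborel. AE y in lborel. H (x, y) = H' (x, y)"
    by (rule lborel_pair.AE_pair)
  then show ?thesis using H' that by simp
qed

text \<open>Reflection and translation preserve null sets, so the exceptional set of
  \<open>f\<close> stays null in the variable \<open>y\<close>.\<close>

lemma maximal_op_cong_AE:
  fixes H :: "(real ^ 'n) \<times> (real ^ 'n) \<Rightarrow> ennreal"
  assumes H: "AE y in lborel. H (x, y) = G y"
    and f: "AE z in lborel. ennreal (cmod (f z)) = F z"
  shows "maximal_op H f x = (SUP s\<in>{0<..}. ennreal (1 / s ^ CARD('n)) * (\<integral>\<^sup>+y\<in>ball 0 s. G y * F (x - y) \<partial>lborel))"
  unfolding maximal_op_def
proof (intro SUP_cong refl arg_cong2[of _ _ _ _ "(*)"])
  fix s :: real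
  have "(\<integral>\<^sup>+y\<in>{y. norm y < s}. H (x, y) * ennreal (cmod (f (x - y))) \<partial>lebesgue)
      = (\<integral>\<^sup>+y\<in>ball 0 s. H (x, y) * ennreal (cmod (f (x - y))) \<partial>lborel)"
    by (simp add: nn_integral_completion ball_def)
  also have "\<dots> = (\<integral>\<^sup>+y\<in>ball 0 s. G y * F (x - y) \<partial>lborel)"
    by (intro nn_integral_cong_AE, use H AE_lborel_diff[OF f, of x] in eventually_elim) simp
  finally show "(\<integral>\<^sup>+y\<in>{y. norm y < s}. H (x, y) * ennreal (cmod (f (x - y))) \<partial>lebesgue)
      = (\<integral>\<^sup>+y\<in>ball 0 s. G y * F (x - y) \<partial>lborel)" .
qed

lemma lebesgue_cmod_ex_borel:
  assumes "f \<in> borel_measurable lebesgue"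
  obtains F :: "real ^ 'n \<Rightarrow> ennreal"
  where "F \<in> borel_measurable borel" "AE z in lborel. ennreal (cmod (f z)) = F z"
proof -
  have "(\<lambda>z. ennreal (cmod (f z))) \<in> borel_measurable lebesgue"
    using assms by measurable
  from completion_ex_borel_measurable[OF this] that show ?thesis by auto
qed

text \<open>With Borel representatives and rational radii the operator is a countable supremum of
  parametrised integrals, hence Borel; it agrees with \<open>maximal_op H f\<close> outside a null
  set.\<close>

lemma maximal_op_measurable:
  fixes H :: "(real ^ 'n) \<times> (real ^ 'n) \<Rightarrow> ennreal"
  assumes H: "H \<in> borel_measurable lebesgue" and f: "f \<in> borel_measurable lebesgue"
  shows "maximal_op H f \<in> borel_measurable lebesgue"
proof -
  obtain H' where H' [measurable]: "H' \<in> borel_measurable borel"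
    and HH': "AE x in lborel. AE y in lborel. H (x, y) = H' (x, y)"
    using lebesgue_prod_ex_borel_sections[OF H] .
  obtain F where F [measurable]: "F \<in> borel_measurable borel"
    and fF: "AE z in lborel. ennreal (cmod (f z)) = F z"
    using lebesgue_cmod_ex_borel[OF f] .
  have [measurable]: "H' \<in> borel_measurable (borel \<Otimes>\<^sub>M borel)"
    using H' by (simp add: borel_prod)
  define g where "g x = (SUP s\<in>{0<..} \<inter> \<rat>. ennreal (1 / s ^ CARD('n))
      * (\<integral>\<^sup>+y\<in>ball 0 s. H' (x, y) * F (x - y) \<partial>lborel))" for x
  have [measurable]: "ball (0 :: real ^ 'n) s \<in> sets borel" for s
    by simp
  have "countable ({0<..} \<inter> \<rat> :: real set)"
    using countable_rat by blast
  then have g: "g \<in> borel_measurable lborel"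
    unfolding g_def[abs_def] by measurable
  have "AE x in lborel. g x = maximal_op H f x"
    using HH'
  proof eventually_elim
    case (elim x)
    show ?case
      unfolding g_def maximal_op_cong_AE[OF elim fF]
      by (rule SUP_ball_eq_SUP_rat[symmetric]) measurable
  qed
  with g show ?thesis
    by (rule measurable_completion_cong_AE) simp
qed

text \<open>The scaling is exact: \<open>1 / m * (C * m)^(1/\<sigma>) = C^(1/\<sigma>) * (1 /
  m)^(1/\<sigma>')\<close> with \<open>m = s ^ n\<close>, so the factor left over from Hoelder
  passes inside the power and becomes the normalisation of \<open>ball_max\<close>.\<close>

lemma maximal_op_le_ball_max:
  fixes H :: "(real ^ 'n) \<times> (real ^ 'n) \<Rightarrow> ennreal"
  assumes \<sigma>: "1 < \<sigma>" "1 / \<sigma> + 1 / \<sigma>' = 1" and C: "0 < C"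
    and H: "H \<in> borel_measurable lebesgue"
    and bound: "\<forall>x. \<forall>s>0. (\<integral>\<^sup>+y\<in>{y. norm y < s}. H (x, y) epowr \<sigma> \<partial>lebesgue) \<le> ennreal (C * s ^ CARD('n))"
    and F [measurable]: "F \<in> borel_measurable borel" and fF: "AE z in lborel. ennreal (cmod (f z)) = F z"
  shows "AE x in lborel. maximal_op H f x
      \<le> ennreal (C powr (1 / \<sigma>)) * ball_max (\<lambda>z. F z epowr \<sigma>') x epowr (1 / \<sigma>')"
proof -
  obtain H' where H' [measurable]: "H' \<in> borel_measurable borel"
    and HH': "AE x in lborel. AE y in lborel. H (x, y) = H' (x, y)"
    using lebesgue_prod_ex_borel_sections[OF H] .
  have \<sigma>': "1 < \<sigma>'"
  proof -
    have "1 / \<sigma>' = 1 - 1 / \<sigma>" "0 < 1 / \<sigma>" "1 / \<sigma> < 1" using \<sigma> by auto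
    then have "0 < 1 / \<sigma>'" "1 / \<sigma>' < 1" by linarith+
    then show ?thesis by (simp add: divide_less_eq_1 zero_less_divide_iff)
  qed
  have [measurable]: "(\<lambda>y. H' (x, y)) \<in> borel_measurable borel" for x
    by (rule measurable_compose[OF _ H']) (intro borel_measurable_Pair; simp)
  have [measurable]: "ball (0 :: real ^ 'n) s \<in> sets borel" for s
    by simp
  show ?thesis
    using HH'
  proof eventually_elim
    case (elim x)
    show ?case
      unfolding maximal_op_cong_AE[OF elim fF]
    proof (rule SUP_least)
      fix s :: real assume "s \<in> {0<..}"
      then have s: "0 < s" by simp
      define m where "m = s ^ CARD('n)"
      have m: "0 < m" using s by (simp add: m_def)
      let ?I = "\<integral>\<^sup>+z\<in>ball x s. F z epowr \<sigma>' \<partial>lborel"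
      have "(\<integral>\<^sup>+y\<in>ball 0 s. H' (x, y) epowr \<sigma> \<partial>lborel) = (\<integral>\<^sup>+y\<in>{y. norm y < s}. H (x, y) epowr \<sigma> \<partial>lebesgue)"
        unfolding nn_integral_completion
        by (intro nn_integral_cong_AE, use elim in eventually_elim) (simp add: ball_def)
      also have "\<dots> \<le> ennreal (C * m)"
        using bound s by (simp add: m_def)
      finally have H'b: "(\<integral>\<^sup>+y\<in>ball 0 s. H' (x, y) epowr \<sigma> \<partial>lborel) \<le> ennreal (C * m)" .
      have "(\<integral>\<^sup>+y\<in>ball 0 s. H' (x, y) * F (x - y) \<partial>lborel)
          = (\<integral>\<^sup>+y. (H' (x, y) * indicator (ball 0 s) y) * (F (x - y) * indicator (ball 0 s) y) \<partial>lborel)"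
        by (intro nn_integral_cong) (auto split: split_indicator)
      also have "\<dots> \<le> (\<integral>\<^sup>+y. (H' (x, y) * indicator (ball 0 s) y) epowr \<sigma> \<partial>lborel) epowr (1 / \<sigma>)
          * (\<integral>\<^sup>+y. (F (x - y) * indicator (ball 0 s) y) epowr \<sigma>' \<partial>lborel) epowr (1 / \<sigma>')"
        using \<sigma> \<sigma>' by (intro nn_integral_Hoelder borel_measurable_times_ennreal borel_measurable_indicator) auto
      also have "(\<integral>\<^sup>+y. (H' (x, y) * indicator (ball 0 s) y) epowr \<sigma> \<partial>lborel)
          = (\<integral>\<^sup>+y\<in>ball 0 s. H' (x, y) epowr \<sigma> \<partial>lborel)"
        using \<sigma> by (intro nn_integral_cong) (auto split: split_indicator simp: epowr_0_left)
      also have "(\<integral>\<^sup>+y. (F (x - y) * indicator (ball 0 s) y) epowr \<sigma>' \<partial>lborel)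
          = (\<integral>\<^sup>+y\<in>ball 0 s. F (x - y) epowr \<sigma>' \<partial>lborel)"
        using \<sigma>' by (intro nn_integral_cong) (auto split: split_indicator simp: epowr_0_left)
      also have "\<dots> = ?I"
        by (rule set_nn_integral_lborel_diff) measurable
      also have "(\<integral>\<^sup>+y\<in>ball 0 s. H' (x, y) epowr \<sigma> \<partial>lborel) epowr (1 / \<sigma>) * ?I epowr (1 / \<sigma>')
          \<le> ennreal (C * m) epowr (1 / \<sigma>) * ?I epowr (1 / \<sigma>')"
        using \<sigma> by (intro mult_right_mono epowr_mono H'b) auto
      finally have "ennreal (1 / m) * (\<integral>\<^sup>+y\<in>ball 0 s. H' (x, y) * F (x - y) \<partial>lborel)
          \<le> ennreal (1 / m) * (ennreal (C * m) epowr (1 / \<sigma>) * ?I epowr (1 / \<sigma>'))"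
        by (rule mult_left_mono) simp
      also have "\<dots> = ennreal (1 / m) * (ennreal (C powr (1 / \<sigma>)) * ennreal (m powr (1 / \<sigma>))) * ?I epowr (1 / \<sigma>')"
      proof -
        have "ennreal (C * m) epowr (1 / \<sigma>) = ennreal (C powr (1 / \<sigma>)) * ennreal (m powr (1 / \<sigma>))"
          using m C by (simp add: ennreal_epowr powr_mult flip: ennreal_mult)
        then show ?thesis by (simp only: mult.assoc)
      qed
      also have "ennreal (1 / m) * (ennreal (C powr (1 / \<sigma>)) * ennreal (m powr (1 / \<sigma>)))
          = ennreal (C powr (1 / \<sigma>)) * ennreal (1 / m) epowr (1 / \<sigma>')"
      proof -
        have "1 / m * (C powr (1 / \<sigma>) * m powr (1 / \<sigma>)) = C powr (1 / \<sigma>) * m powr (1 / \<sigma> - 1)"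
          using m by (simp add: powr_diff)
        also have "1 / \<sigma> - 1 = - (1 / \<sigma>')" using \<sigma> by simp
        also have "m powr - (1 / \<sigma>') = (1 / m) powr (1 / \<sigma>')"
          using m by (simp add: powr_minus_divide powr_divide)
        finally show ?thesis
          using m by (simp add: ennreal_epowr flip: ennreal_mult)
      qed
      also have "ennreal (C powr (1 / \<sigma>)) * ennreal (1 / m) epowr (1 / \<sigma>') * ?I epowr (1 / \<sigma>')
          = ennreal (C powr (1 / \<sigma>)) * (ennreal (1 / m) * ?I) epowr (1 / \<sigma>')"
        using \<sigma>' by (simp add: epowr_mult mult.assoc)
      also have "\<dots> \<le> ennreal (C powr (1 / \<sigma>)) * ball_max (\<lambda>z. F z epowr \<sigma>') x epowr (1 / \<sigma>')"
        using s \<sigma>' unfolding ball_max_def m_def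
        by (intro mult_left_mono epowr_mono SUP_upper2[of s]) auto
      finally show "ennreal (1 / s ^ CARD('n)) * (\<integral>\<^sup>+y\<in>ball 0 s. H' (x, y) * F (x - y) \<partial>lborel)
          \<le> ennreal (C powr (1 / \<sigma>)) * ball_max (\<lambda>z. F z epowr \<sigma>') x epowr (1 / \<sigma>')"
        by (simp add: m_def)
    qed
  qed
qed

section \<open>The weighted estimate and the theorem\<close>

lemma ball_max_0: "ball_max (\<lambda>_. 0) x = 0"
  by (simp add: ball_max_def SUP_constant)

text \<open>The constant of \<open>ball_max_strong_type\<close> without \<open>A\<close>, times
  \<open>(2 powr t) ^ d\<close> from replacing cubes by balls. Neither the weight nor
  \<open>K\<close> nor \<open>H\<close> enters, so it can be fixed before them.\<close>

definition strong_type_const :: "real \<Rightarrow> real \<Rightarrow> nat \<Rightarrow> real" where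
  "strong_type_const t q d
     = q / (q - t) * 2 powr t * (5 powr t) ^ d * (2 * unit_ball_vol d) powr (q - t) * (2 powr t) ^ d"

lemma strong_type_const_pos:
  assumes "1 < t" "t < q"
  shows "0 < strong_type_const t q d"
proof -
  have "unit_ball_vol (real d) \<noteq> 0"
    using unit_ball_vol_pos[of "real d"] by linarith
  then show ?thesis
    using assms by (simp add: strong_type_const_def)
qed

lemma maximal_op_weighted_bound:
  fixes H :: "(real ^ 'n) \<times> (real ^ 'n) \<Rightarrow> ennreal" and w :: "real ^ 'n \<Rightarrow> ennreal"
  assumes p: "1 < p" and t: "1 < t" "t < p / \<sigma>'" and K: "0 < K"
    and w: "muckenhoupt p t K w" and w_meas: "w \<in> borel_measurable lebesgue"
    and \<sigma>: "1 < \<sigma>" "1 < \<sigma>'" "1 / \<sigma> + 1 / \<sigma>' = 1" and C: "0 < C"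
    and H: "H \<in> borel_measurable lebesgue"
    and bound: "\<forall>x. \<forall>s>0. (\<integral>\<^sup>+y\<in>{y. norm y < s}. H (x, y) epowr \<sigma> \<partial>lebesgue) \<le> ennreal (C * s ^ CARD('n))"
    and f: "f \<in> borel_measurable lebesgue"
  shows "(\<integral>\<^sup>+x. maximal_op H f x epowr p * w x \<partial>lborel)
      \<le> ennreal (C powr (p / \<sigma>) * strong_type_const t (p / \<sigma>') CARD('n) * K powr p)
         * (\<integral>\<^sup>+x. ennreal (cmod (f x)) epowr p * w x \<partial>lborel)"
    (is "?L \<le> ennreal ?D * ?R")
proof -
  have D: "0 < ?D"
    using t K C by (simp add: strong_type_const_pos)
  obtain F where F [measurable]: "F \<in> borel_measurable borel"
    and fF: "AE z in lborel. ennreal (cmod (f z)) = F z"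
    using lebesgue_cmod_ex_borel[OF f] .
  from muckenhoupt_trichotomy[OF p t(1) w w_meas]
  consider "AE x in lborel. w x = 0" | "AE x in lborel. w x = top" | "AE x in lborel. 0 < w x \<and> w x < top"
    by (auto simp: AE_completion_iff)
  then show ?thesis
  proof cases
    case 1
    then have "?L = (\<integral>\<^sup>+x. 0 \<partial>(lborel :: (real ^ 'n) measure))"
      by (intro nn_integral_cong_AE) (auto elim!: eventually_mono)
    then show ?thesis by simp
  next
    \<comment> \<open>For \<open>w = top\<close> a finite right side forces \<open>f = 0\<close>
      almost everywhere, and then \<open>maximal_op H f = 0\<close> almost everywhere by the kernel
      estimate with 0 as representative of \<open>f\<close>. If the right integral is infinite, the
      positivity of the constant matters, as \<open>0 * top = 0\<close>.\<close>
    case 2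
    show ?thesis
    proof (cases "?R = top")
      case True
      moreover have "ennreal ?D \<noteq> 0" using D by (simp only: ennreal_eq_0_iff not_le)
      ultimately show ?thesis by (simp only: ennreal_mult_top if_False top_greatest)
    next
      case False
      have "?R = (\<integral>\<^sup>+x. F x epowr p * top \<partial>lborel)"
        by (intro nn_integral_cong_AE, use fF 2 in eventually_elim) simp
      with False have "AE x in lborel. F x epowr p * top \<noteq> \<infinity>"
        by (intro nn_integral_PInf_AE) auto
      with fF have "AE x in lborel. ennreal (cmod (f x)) = 0"
      proof eventually_elim
        case (elim x)
        then show ?case using p by (auto simp: ennreal_mult_eq_top_iff epowr_eq_0_iff)
      qed
      then have "AE x in lborel. maximal_op H f x
          \<le> ennreal (C powr (1 / \<sigma>)) * ball_max (\<lambda>z. 0 epowr \<sigma>') x epowr (1 / \<sigma>')"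
        using \<sigma> C H bound by (intro maximal_op_le_ball_max) auto
      then have "AE x in lborel. maximal_op H f x = 0"
        by eventually_elim (use \<sigma> in \<open>simp add: epowr_0_left ball_max_0\<close>)
      then have "?L = (\<integral>\<^sup>+x. 0 \<partial>(lborel :: (real ^ 'n) measure))"
        using p by (intro nn_integral_cong_AE) (auto elim!: eventually_mono simp: epowr_0_left)
      then show ?thesis by simp
    qed
  next
    case 3
    obtain W0 where W0 [measurable]: "W0 \<in> borel_measurable borel" and wW0: "AE x in lborel. w x = W0 x"
      using completion_ex_borel_measurable[OF w_meas] by auto
    \<comment> \<open>Redefining the weight as 1 on a null set gives a Borel function strictly
      between 0 and \<open>top\<close> everywhere, as the ball estimates require.\<close>
    define W where "W x = (if 0 < W0 x \<and> W0 x < top then W0 x else 1)" for x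
    have W [measurable]: "W \<in> borel_measurable borel" and W_pos: "0 < W x" "W x < top" for x
      unfolding W_def by auto
    have wW: "AE x in lborel. w x = W x"
      using 3 wW0 by eventually_elim (auto simp: W_def)
    let ?G = "\<lambda>z. F z epowr \<sigma>'" and ?q = "p / \<sigma>'"
    let ?A = "K powr p * (2 powr t) ^ CARD('n)"
    have "?L \<le> (\<integral>\<^sup>+x. ennreal (C powr (p / \<sigma>)) * (ball_max ?G x epowr ?q * W x) \<partial>lborel)"
    proof (intro nn_integral_mono_AE, use wW maximal_op_le_ball_max[OF \<sigma>(1,3) C H bound F fF] in eventually_elim)
      case (elim x)
      have "maximal_op H f x epowr p \<le> (ennreal (C powr (1 / \<sigma>)) * ball_max ?G x epowr (1 / \<sigma>')) epowr p"
        using elim p by (intro epowr_mono) auto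
      also have "\<dots> = ennreal (C powr (p / \<sigma>)) * ball_max ?G x epowr ?q"
        using p C by (simp add: epowr_mult epowr_epowr ennreal_epowr powr_powr)
      finally show ?case
        using elim by (simp add: mult_right_mono mult.assoc[symmetric])
    qed
    also have "\<dots> = ennreal (C powr (p / \<sigma>)) * (\<integral>\<^sup>+x. ball_max ?G x epowr ?q * W x \<partial>lborel)"
      by (intro nn_integral_cmult) measurable
    also have "(\<integral>\<^sup>+x. ball_max ?G x epowr ?q * W x \<partial>lborel)
        \<le> ennreal (?q / (?q - t) * 2 powr t * (5 powr t) ^ DIM(real ^ 'n)
            * (2 * unit_ball_vol DIM(real ^ 'n)) powr (?q - t) * ?A) * (\<integral>\<^sup>+x. ?G x epowr ?q * W x \<partial>lborel)"
      using t W_pos muckenhoupt_imp_muckenhoupt_ball[OF p t(1) K w wW] K by (intro ball_max_strong_type) auto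
    also have "?q / (?q - t) * 2 powr t * (5 powr t) ^ DIM(real ^ 'n)
            * (2 * unit_ball_vol DIM(real ^ 'n)) powr (?q - t) * ?A = strong_type_const t ?q CARD('n) * K powr p"
      by (simp add: strong_type_const_def)
    also have "(\<integral>\<^sup>+x. ?G x epowr ?q * W x \<partial>lborel) = ?R"
      using \<sigma> by (intro nn_integral_cong_AE, use wW fF in eventually_elim) (simp add: epowr_epowr)
    finally have "?L \<le> ennreal (C powr (p / \<sigma>)) * (ennreal (strong_type_const t ?q CARD('n) * K powr p) * ?R)"
      by (simp add: mult_left_mono)
    also have "\<dots> = ennreal ?D * ?R"
      using D by (simp add: mult.assoc[symmetric] flip: ennreal_mult')
    finally show ?thesis .
  qed
qed

theorem theorem2p1:
  fixes p p' r r' \<sigma> C\<^sub>H :: real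
  assumes "1 < p" and "1 / p + 1 / p' = 1"
    and "1 < r" and "1 / r + 1 / r' = 1"
    and "r' * p' < \<sigma>" and "0 < C\<^sub>H"
  shows "\<exists>C>0. \<forall>(w :: real ^ 'n \<Rightarrow> ennreal) (K :: real) (H :: (real ^ 'n) \<times> (real ^ 'n) \<Rightarrow> ennreal).
           weight w \<longrightarrow> 0 < K \<longrightarrow>
           (\<forall>Q\<in>cubes. average Q w epowr (1 / p) *
                average Q (\<lambda>x. w x epowr (- (r * p' / p))) epowr (1 / (r * p')) \<le> ennreal K) \<longrightarrow>
           H \<in> borel_measurable lebesgue \<longrightarrow>
           (\<forall>x. \<forall>s>0. (\<integral>\<^sup>+y\<in>{y. norm y < s}. H (x, y) epowr \<sigma> \<partial>lebesgue)
                \<le> ennreal (C\<^sub>H * s ^ CARD('n))) \<longrightarrow>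
           Lpw_bounded p w (maximal_op H) \<and>
           Lpw_op_norm p w (maximal_op H) \<le> ennreal (C * K)"
proof -
  define t where "t = 1 + (p - 1) / r"
  define \<sigma>' where "\<sigma>' = \<sigma> / (\<sigma> - 1)"
  \<comment> \<open>Since \<open>1 / 0 = 0\<close>, conjugacy with \<open>p > 1\<close> and
    \<open>r > 1\<close> excludes \<open>p' = 0\<close> and \<open>r' = 0\<close>, so inverting
    these equations determines both exponents.\<close>
  have "1 / p' = (p - 1) / p" "1 / r' = (r - 1) / r"
    using assms by (auto simp: field_simps)
  then have p': "p' = p / (p - 1)" and r': "r' = r / (r - 1)"
    using assms by (metis div_by_1 divide_divide_eq_right mult_1)+
  have t: "1 < t" using assms by (simp add: t_def)
  have exps: "- (r * p' / p) = - 1 / (t - 1)" "1 / (r * p') = (t - 1) / p"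
    using assms by (simp_all add: t_def p')
  have "1 < r'" "1 < p'" using assms by (simp_all add: p' r')
  then have "1 < r' * p'" by (simp add: less_1_mult)
  then have \<sigma>: "1 < \<sigma>" using assms by simp
  have \<sigma>': "1 < \<sigma>'" "1 / \<sigma> + 1 / \<sigma>' = 1" using \<sigma> by (simp_all add: \<sigma>'_def field_simps)
  have "1 / \<sigma> < 1 / (r' * p')"
    using assms \<open>1 < r' * p'\<close> by (intro divide_strict_left_mono) auto
  \<comment> \<open>Both sides equal \<open>(p - 1) * (r - 1) / (p * r)\<close>; here the threshold
    \<open>r' * p'\<close> for \<open>\<sigma>\<close> turns into
    \<open>t < p / \<sigma>'\<close>.\<close>
  also have "1 / (r' * p') = 1 - t / p"
    using assms by (simp add: t_def p' r' field_simps)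
  finally have "t / p < 1 / \<sigma>'" using \<sigma>' by simp
  then have tq: "t < p / \<sigma>'" using assms \<sigma>' by (simp add: field_simps)
  \<comment> \<open>Fixed before \<open>w\<close>, \<open>K\<close> and \<open>H\<close>. The bound
    between p-th powers of norms has the constant \<open>D * K powr p\<close>, whose p-th root is
    linear in \<open>K\<close>.\<close>
  define D where "D = C\<^sub>H powr (p / \<sigma>) * strong_type_const t (p / \<sigma>') CARD('n)"
  have D: "0 < D"
    using assms(6) t tq by (simp add: D_def strong_type_const_pos)
  show ?thesis
  proof (intro exI[of _ "D powr (1 / p)"] conjI allI impI)
    show "0 < D powr (1 / p)" using D by simp
  next
    fix w :: "real ^ 'n \<Rightarrow> ennreal" and K :: real and H :: "(real ^ 'n) \<times> (real ^ 'n) \<Rightarrow> ennreal"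
    assume w: "weight w" and K: "0 < K"
      and A: "\<forall>Q\<in>cubes. average Q w epowr (1 / p) *
                average Q (\<lambda>x. w x epowr (- (r * p' / p))) epowr (1 / (r * p')) \<le> ennreal K"
      and H: "H \<in> borel_measurable lebesgue"
      and bound: "\<forall>x. \<forall>s>0. (\<integral>\<^sup>+y\<in>{y. norm y < s}. H (x, y) epowr \<sigma> \<partial>lebesgue)
                \<le> ennreal (C\<^sub>H * s ^ CARD('n))"
    have w_meas [measurable]: "w \<in> borel_measurable lebesgue" using w by (simp add: weight_def)
    have mw: "muckenhoupt p t K w" using A by (simp add: muckenhoupt_def exps)
    have norm_eq: "Lpw_norm p w g = (\<integral>\<^sup>+x. g x epowr p * w x \<partial>lborel) epowr (1 / p)"
      if [measurable]: "g \<in> borel_measurable lebesgue" for g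
      unfolding Lpw_norm_def
      by (subst nn_integral_density) (simp_all add: nn_integral_completion mult.commute)
    have le: "Lpw_norm p w (maximal_op H f) \<le> ennreal (D powr (1 / p) * K) * Lpw_norm p w (\<lambda>x. ennreal (cmod (f x)))"
      if f: "f \<in> borel_measurable lebesgue" for f
    proof -
      have "(\<lambda>x. ennreal (cmod (f x))) \<in> borel_measurable lebesgue" using f by measurable
      note eqs = norm_eq[OF maximal_op_measurable[OF H f]] norm_eq[OF this]
      have "(\<integral>\<^sup>+x. maximal_op H f x epowr p * w x \<partial>lborel)
          \<le> ennreal (D * K powr p) * (\<integral>\<^sup>+x. ennreal (cmod (f x)) epowr p * w x \<partial>lborel)"
        unfolding D_def using assms t tq K mw \<sigma> \<sigma>' H bound f
        by (intro maximal_op_weighted_bound) auto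
      then have "Lpw_norm p w (maximal_op H f)
          \<le> (ennreal (D * K powr p) * (\<integral>\<^sup>+x. ennreal (cmod (f x)) epowr p * w x \<partial>lborel)) epowr (1 / p)"
        unfolding eqs using assms(1) by (intro epowr_mono) auto
      also have "\<dots> = ennreal (D powr (1 / p) * K) * Lpw_norm p w (\<lambda>x. ennreal (cmod (f x)))"
        unfolding eqs using assms(1) D K by (simp add: epowr_mult ennreal_epowr powr_mult powr_powr)
      finally show ?thesis .
    qed
    show op: "Lpw_op_norm p w (maximal_op H) \<le> ennreal (D powr (1 / p) * K)"
      unfolding Lpw_op_norm_def using le by (intro Inf_lower) (auto simp: Lpw_def)
    show "Lpw_bounded p w (maximal_op H)"
      unfolding Lpw_bounded_def
    proof (intro conjI ballI)
      fix f :: "real ^ 'n \<Rightarrow> complex" assume f: "f \<in> Lpw p w"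
      then have fm: "f \<in> borel_measurable lebesgue" by (simp add: Lpw_def)
      have "Lpw_norm p w (maximal_op H f) < \<infinity>"
        using le[OF fm] f by (auto simp: Lpw_def ennreal_mult_less_top intro: order_le_less_trans)
      then show "maximal_op H f \<in> Lpw_nonneg p w"
        using maximal_op_measurable[OF H fm] by (simp add: Lpw_nonneg_def)
    qed (use op order_le_less_trans in fastforce)
  qed
qed

end
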